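(* Let $Q=(q_1,\dots,q_n)$ with $q_i\in\mathbb C\setminus\{0,1\}$ and $\Lambda=(\lambda_{ij})$ an $n\times n$ matrix over $\mathbb C\setminus\{0\}$ with $\lambda_{ii}=1$, $\lambda_{ij}=\lambda_{ji}^{-1}$; let $G(Q,\Lambda)$ be the subgroup of $\mathbb C^\times$ generated by all $q_i,\lambda_{ij}$ and assume it is torsion free, free abelian of rank $r$ with fixed basis $\eta_1,\dots,\eta_r$. Fix a $\mathbb Q$-linearly independent set $\{\mu_1,\dots,\mu_r\}\subset\mathbb C$ and $q\in\mathbb C\setminus\{0,1\}$ not a root of unity. Let $e_i\in\mathbb C[t]$ be the unique polynomial of degree $\le2$ with $e_i(q)=\eta_i$, $e_i(1)=1$, $e_i'(1)=\mu_i$; let $\mathbb F=\mathbb C[t,t^{-1}][e_1^{-1},\dots,e_r^{-1}]$, and define the group monomorphism $c\mapsto\widetilde c$ from $G(Q,\Lambda)$ to the units of $\mathbb F$ by $\widetilde{\eta_1^{s_1}\cdots\eta_r^{s_r}}=e_1^{s_1}\cdots e_r^{s_r}$. Let $A$ be the $\mathbb F$-algebra generated by $y_1,x_1,\dots,y_n,x_n$ with relations, for $1\le i<j\le n$, $$y_jy_i=\widetilde\lambda_{ji}y_iy_j,\ \ y_jx_i=\widetilde\lambda_{ij}x_iy_j,\ \ x_jy_i=\widetilde q_i\widetilde\lambda_{ij}y_ix_j,\ \ x_jx_i=\widetilde q_i^{-1}\widetilde\lambda_{ij}^{-1}x_ix_j,$$ and for $1\le i\le n$, $x_iy_i-\widetilde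 q_iy_ix_i=(\widetilde q_i-1)\bigl(1+\sum_{k=1}^{i-1}y_kx_k\bigr)$. Then: (1) $\widetilde q_i'(1)\neq0$ for all $i=1,\dots,n$; (2) the matrix $(\widetilde\lambda_{ij}'(1))$ is a skew-symmetric $n\times n$ matrix over $\mathbb C$; (3) $A_1:=A/(t-1)A$ is commutative, and with the Poisson bracket $\{\bar a,\bar b\}=\overline{(t-1)^{-1}(ab-ba)}$ it is the Poisson algebra $\mathbb C[y_1,x_1,\dots,y_n,x_n]$ (polynomial ring) with bracket given by, for $1\le i<j\le n$, $$\{y_j,y_i\}=\widetilde\lambda_{ji}'(1)y_iy_j,\quad\{y_j,x_i\}=\widetilde\lambda_{ij}'(1)x_iy_j,\quad\{x_j,y_i\}=(\widetilde q_i'(1)+\widetilde\lambda_{ij}'(1))y_ix_j,\quad\{x_j,x_i\}=-(\widetilde q_i'(1)+\widetilde\lambda_{ij}'(1))x_ix_j,$$ and for $1\le i\le n$, $\{x_i,y_i\}=\widetilde q_i'(1)\bigl(1+\sum_{k=1}^{i}y_kx_k\bigr)$.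
   Context: Primes denote formal derivatives in $t$, evaluated at $t=1$. Here $t-1$ is a nonzero, nonunit, non-zero-divisor of $A$, so the bracket on the commutative algebra $A/(t-1)A$ is well defined. $A_1$ is called the multi-parameter Poisson Weyl algebra. *)

theory Defs
  imports "HOL-Algebra.QuotRing" "HOL-Library.Poly_Mapping"
          "HOL-Computational_Algebra.Polynomial" "HOL-Computational_Algebra.Fraction_Field"
begin

type_synonym cf = "complex poly fract"
type_synonym fa = "nat list \<Rightarrow> cf"     (* elements of a free algebra: coefficient of each word *)

definition Ggen :: "nat \<Rightarrow> (nat \<Rightarrow> complex) \<Rightarrow> (nat \<Rightarrow> nat \<Rightarrow> complex) \<Rightarrow> complex set" where
  "Ggen n Q L = {(\<Prod>i\<in>{1..n}. Q i powi a i) * (\<Prod>i\<in>{1..n}. \<Prod>j\<in>{1..n}. L i j powi b i j)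
                 | (a :: nat \<Rightarrow> int) (b :: nat \<Rightarrow> nat \<Rightarrow> int). True}"

definition e_poly :: "complex \<Rightarrow> complex \<Rightarrow> complex \<Rightarrow> complex poly" where
  "e_poly q eta mu = (THE p. degree p \<le> 2 \<and> poly p q = eta \<and> poly p 1 = 1 \<and> poly (pderiv p) 1 = mu)"

definition Fset :: "nat \<Rightarrow> (nat \<Rightarrow> complex poly) \<Rightarrow> cf set" where
  "Fset r E = {Fract p (monom 1 a * (\<Prod>i\<in>{1..r}. E i ^ k i)) | p (a :: nat) (k :: nat \<Rightarrow> nat). True}"

definition tilde :: "nat \<Rightarrow> (nat \<Rightarrow> complex) \<Rightarrow> (nat \<Rightarrow> complex poly) \<Rightarrow> complex \<Rightarrow> cf" where
  "tilde r eta E c =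
     (let s = (THE s :: nat \<Rightarrow> int. (\<forall>i. i \<notin> {1..r} \<longrightarrow> s i = 0) \<and> c = (\<Prod>i\<in>{1..r}. eta i powi s i))
      in \<Prod>i\<in>{1..r}. Fract (E i) 1 powi s i)"

definition ev1 :: "cf \<Rightarrow> complex" where
  "ev1 f = (THE v. \<exists>p d. f = Fract p d \<and> poly d 1 \<noteq> 0 \<and> v = poly p 1 / poly d 1)"

definition d1 :: "cf \<Rightarrow> complex" where
  "d1 f = (THE v. \<exists>p d. f = Fract p d \<and> poly d 1 \<noteq> 0 \<and>
              v = (poly (pderiv p) 1 * poly d 1 - poly p 1 * poly (pderiv d) 1) / (poly d 1)\<^sup>2)"

definition cst :: "complex \<Rightarrow> cf" where "cst z = Fract [:z:] 1"

definition FA :: "cf set \<Rightarrow> nat set \<Rightarrow> fa ring" where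
  "FA S V = \<lparr>carrier = {f. finite {w. f w \<noteq> 0} \<and> (\<forall>w. f w \<in> S) \<and> (\<forall>w. f w \<noteq> 0 \<longrightarrow> set w \<subseteq> V)},
             Group.monoid.mult = (\<lambda>f g w. \<Sum>k\<le>length w. f (take k w) * g (drop k w)),
             Group.monoid.one = (\<lambda>w. if w = [] then 1 else 0),
             zero = (\<lambda>w. 0),
             add = (\<lambda>f g w. f w + g w)\<rparr>"

definition gen :: "nat \<Rightarrow> fa" where "gen k = (\<lambda>w. if w = [k] then 1 else 0)"
definition sc :: "cf \<Rightarrow> fa" where "sc c = (\<lambda>w. if w = [] then c else 0)"

definition Yg :: "nat \<Rightarrow> fa" where "Yg i = gen (2 * i)"
definition Xg :: "nat \<Rightarrow> fa" where "Xg i = gen (2 * i + 1)"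
definition Vn :: "nat \<Rightarrow> nat set" where "Vn n = {2 * i | i. i \<in> {1..n}} \<union> {2 * i + 1 | i. i \<in> {1..n}}"

definition rels :: "nat \<Rightarrow> cf set \<Rightarrow> (nat \<Rightarrow> cf) \<Rightarrow> (nat \<Rightarrow> nat \<Rightarrow> cf) \<Rightarrow> fa set" where
  "rels n S tq tlam = (let R = FA S (Vn n) in
     {Yg j \<otimes>\<^bsub>R\<^esub> Yg i \<ominus>\<^bsub>R\<^esub> sc (tlam j i) \<otimes>\<^bsub>R\<^esub> Yg i \<otimes>\<^bsub>R\<^esub> Yg j | i j. 1 \<le> i \<and> i < j \<and> j \<le> n}
   \<union> {Yg j \<otimes>\<^bsub>R\<^esub> Xg i \<ominus>\<^bsub>R\<^esub> sc (tlam i j) \<otimes>\<^bsub>R\<^esub> Xg i \<otimes>\<^bsub>R\<^esub> Yg j | i j. 1 \<le> i \<and> i < j \<and> j \<le> n}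
   \<union> {Xg j \<otimes>\<^bsub>R\<^esub> Yg i \<ominus>\<^bsub>R\<^esub> sc (tq i * tlam i j) \<otimes>\<^bsub>R\<^esub> Yg i \<otimes>\<^bsub>R\<^esub> Xg j | i j. 1 \<le> i \<and> i < j \<and> j \<le> n}
   \<union> {Xg j \<otimes>\<^bsub>R\<^esub> Xg i \<ominus>\<^bsub>R\<^esub> sc (inverse (tq i) * inverse (tlam i j)) \<otimes>\<^bsub>R\<^esub> Xg i \<otimes>\<^bsub>R\<^esub> Xg j
        | i j. 1 \<le> i \<and> i < j \<and> j \<le> n}
   \<union> {Xg i \<otimes>\<^bsub>R\<^esub> Yg i \<ominus>\<^bsub>R\<^esub> sc (tq i) \<otimes>\<^bsub>R\<^esub> Yg i \<otimes>\<^bsub>R\<^esub> Xg i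
        \<ominus>\<^bsub>R\<^esub> sc (tq i - 1) \<otimes>\<^bsub>R\<^esub> (\<one>\<^bsub>R\<^esub> \<oplus>\<^bsub>R\<^esub> (\<Oplus>\<^bsub>R\<^esub>k\<in>{1..<i}. Yg k \<otimes>\<^bsub>R\<^esub> Xg k))
        | i. 1 \<le> i \<and> i \<le> n})"

definition Aalg :: "nat \<Rightarrow> cf set \<Rightarrow> (nat \<Rightarrow> cf) \<Rightarrow> (nat \<Rightarrow> nat \<Rightarrow> cf) \<Rightarrow> fa set ring" where
  "Aalg n S tq tlam = FA S (Vn n) Quot genideal (FA S (Vn n)) (rels n S tq tlam)"

definition clsA :: "nat \<Rightarrow> cf set \<Rightarrow> (nat \<Rightarrow> cf) \<Rightarrow> (nat \<Rightarrow> nat \<Rightarrow> cf) \<Rightarrow> fa \<Rightarrow> fa set" where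
  "clsA n S tq tlam x = genideal (FA S (Vn n)) (rels n S tq tlam) +>\<^bsub>FA S (Vn n)\<^esub> x"

definition tm1 :: "nat \<Rightarrow> cf set \<Rightarrow> (nat \<Rightarrow> cf) \<Rightarrow> (nat \<Rightarrow> nat \<Rightarrow> cf) \<Rightarrow> fa set" where
  "tm1 n S tq tlam = clsA n S tq tlam (sc (Fract [:-1, 1:] 1))"

definition tm1A :: "nat \<Rightarrow> cf set \<Rightarrow> (nat \<Rightarrow> cf) \<Rightarrow> (nat \<Rightarrow> nat \<Rightarrow> cf) \<Rightarrow> fa set set" where
  "tm1A n S tq tlam = {tm1 n S tq tlam \<otimes>\<^bsub>Aalg n S tq tlam\<^esub> a | a. a \<in> carrier (Aalg n S tq tlam)}"

definition A1alg :: "nat \<Rightarrow> cf set \<Rightarrow> (nat \<Rightarrow> cf) \<Rightarrow> (nat \<Rightarrow> nat \<Rightarrow> cf) \<Rightarrow> fa set set ring" where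
  "A1alg n S tq tlam = Aalg n S tq tlam Quot tm1A n S tq tlam"

definition cls1 :: "nat \<Rightarrow> cf set \<Rightarrow> (nat \<Rightarrow> cf) \<Rightarrow> (nat \<Rightarrow> nat \<Rightarrow> cf) \<Rightarrow> fa \<Rightarrow> fa set set" where
  "cls1 n S tq tlam x = tm1A n S tq tlam +>\<^bsub>Aalg n S tq tlam\<^esub> clsA n S tq tlam x"

definition PB :: "nat \<Rightarrow> cf set \<Rightarrow> (nat \<Rightarrow> cf) \<Rightarrow> (nat \<Rightarrow> nat \<Rightarrow> cf) \<Rightarrow> fa set \<Rightarrow> fa set \<Rightarrow> fa set set" where
  "PB n S tq tlam a b = (let A = Aalg n S tq tlam in
     tm1A n S tq tlam +>\<^bsub>A\<^esub>
       (SOME d. d \<in> carrier A \<and> tm1 n S tq tlam \<otimes>\<^bsub>A\<^esub> d = a \<otimes>\<^bsub>A\<^esub> b \<ominus>\<^bsub>A\<^esub> b \<otimes>\<^bsub>A\<^esub> a))"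

type_synonym cpoly = "(nat \<Rightarrow>\<^sub>0 nat) \<Rightarrow>\<^sub>0 complex"

definition PR :: "nat set \<Rightarrow> cpoly ring" where
  "PR V = \<lparr>carrier = {p :: cpoly. \<forall>m\<in>Poly_Mapping.keys p. Poly_Mapping.keys m \<subseteq> V}, Group.monoid.mult = (*), Group.monoid.one = 1, zero = 0, add = (+)\<rparr>"

definition pvar :: "nat \<Rightarrow> cpoly" where "pvar v = Poly_Mapping.single (Poly_Mapping.single v 1) 1"
definition pconst :: "complex \<Rightarrow> cpoly" where "pconst z = Poly_Mapping.single 0 z"

end

theory Submission
  imports Defs "HOL-Library.Function_Algebras" "HOL-Computational_Algebra.Formal_Power_Series"
    "HOL-Library.Multiset"
begin

text \<open>Write \<open>R\<close> for the free algebra, \<open>I\<close> for the ideal of the relations and \<open>\<tau> = t - 1\<close>. Specialising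
  the coefficients at \<open>t = 1\<close> and letting the letters commute defines \<open>Phi : R \<rightarrow> \<complex>[y, x]\<close>, which kills
  \<open>I\<close> and \<open>\<tau>\<close>. Each commutator of two letters is \<open>\<tau>\<close> times an explicit element modulo \<open>I\<close>, so
  letters commute in \<open>A\<^sub>1\<close>; sorting words then shows that the kernel of \<open>Phi\<close> is \<open>I + \<tau> R\<close>.
  The bracket is well defined once \<open>\<tau> f \<in> I\<close> implies \<open>Phi f = 0\<close>. No PBW basis is needed
  for this: the algebra acts on a family of torsion-free weight modules, parametrised by the points with nonzero
  coordinates, whose reduction at \<open>t = 1\<close> evaluates \<open>Phi f\<close> at the given point.\<close>

section \<open>Fractions regular at \<open>t = 1\<close>\<close>

text \<open>The bracket divides a commutator by \<open>tau\<close> inside \<open>A\<close>, and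
  \<open>PB\<close> takes whichever quotient \<open>SOME\<close> picks; the obstacle is that two
  quotients may differ by an element killed by \<open>tau\<close>. Such a difference has to vanish
  in \<open>A_1\<close>, that is, under \<open>Phi\<close>, which is weaker than vanishing in
  \<open>A\<close>. The modules take values in the whole fraction field, where \<open>tau\<close>
  can be cancelled; regularity at \<open>t = 1\<close> is tracked only for the vectors obtained from
  the constant function 1. One module sees \<open>Phi f\<close> at one point, hence a family of
  them, and a polynomial that vanishes off the coordinate hyperplanes is zero. Nonzero coordinates
  are the price of writing \<open>x_j\<close> as the inverse of \<open>y_j\<close> times a
  difference of normal elements. The derivatives in the brackets arise by writing a scalar of value
  1 as \<open>1 + tau * c\<close>: the value of \<open>c\<close> at 1 is the derivative of the
  scalar.\<close>

definition regular_at_1 :: "cf \<Rightarrow> bool" where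
  "regular_at_1 f \<longleftrightarrow> (\<exists>p d. f = Fract p d \<and> poly d 1 \<noteq> 0)"

lemma regular_at_1_Fract: "poly d 1 \<noteq> 0 \<Longrightarrow> regular_at_1 (Fract p d)"
  unfolding regular_at_1_def by blast

lemma ev1_Fract:
  assumes "poly d 1 \<noteq> 0"
  shows "ev1 (Fract p d) = poly p 1 / poly d 1"
  unfolding ev1_def
proof (rule the_equality)
  fix v assume "\<exists>p' d'. Fract p d = Fract p' d' \<and> poly d' 1 \<noteq> 0 \<and> v = poly p' 1 / poly d' 1"
  then obtain p' d' where 1: "Fract p d = Fract p' d'" "poly d' 1 \<noteq> 0" "v = poly p' 1 / poly d' 1"
    by blast
  then have "p * d' = p' * d" using assms by (subst (asm) eq_fract(1)) auto
  then have "poly p 1 * poly d' 1 = poly p' 1 * poly d 1" by (metis poly_mult)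
  then show "v = poly p 1 / poly d 1" using 1 assms by (simp add: frac_eq_eq)
qed (use assms in blast)

text \<open>Differentiating the cross-multiplied identity at 1 determines
  \<open>poly (pderiv p') 1\<close> from the other data, and the quotient rule then gives the same
  number for both representing fractions.\<close>

lemma d1_Fract:
  assumes "poly d 1 \<noteq> 0"
  shows "d1 (Fract p d)
    = (poly (pderiv p) 1 * poly d 1 - poly p 1 * poly (pderiv d) 1) / (poly d 1)\<^sup>2"
  unfolding d1_def
proof (rule the_equality)
  fix v assume "\<exists>p' d'. Fract p d = Fract p' d' \<and> poly d' 1 \<noteq> 0 \<and>
    v = (poly (pderiv p') 1 * poly d' 1 - poly p' 1 * poly (pderiv d') 1) / (poly d' 1)\<^sup>2"
  then obtain p' d' where 1: "Fract p d = Fract p' d'" "poly d' 1 \<noteq> 0"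
    and v: "v = (poly (pderiv p') 1 * poly d' 1 - poly p' 1 * poly (pderiv d') 1) / (poly d' 1)\<^sup>2"
    by blast
  then have eq: "p * d' = p' * d" using assms by (subst (asm) eq_fract(1)) auto
  then have a: "poly p' 1 = poly p 1 * poly d' 1 / poly d 1"
    using assms by (metis nonzero_mult_div_cancel_right poly_mult)
  have "poly (pderiv p') 1 * poly d 1 + poly p' 1 * poly (pderiv d) 1
      = poly (pderiv p) 1 * poly d' 1 + poly p 1 * poly (pderiv d') 1"
    using arg_cong[OF eq, of "\<lambda>p. poly (pderiv p) 1"] by (simp add: pderiv_mult algebra_simps)
  then have b: "poly (pderiv p') 1 = (poly (pderiv p) 1 * poly d' 1 + poly p 1 * poly (pderiv d') 1
      - poly p' 1 * poly (pderiv d) 1) / poly d 1"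
    using assms by (simp add: field_simps)
  show "v = (poly (pderiv p) 1 * poly d 1 - poly p 1 * poly (pderiv d) 1) / (poly d 1)\<^sup>2"
    unfolding v b a using assms 1(2) by (simp add: divide_simps) (simp add: algebra_simps power2_eq_square)
qed (use assms in blast)

lemma regular_at_1E:
  assumes "regular_at_1 f"
  obtains p d where "f = Fract p d" "poly d 1 \<noteq> 0" "d \<noteq> 0"
  using assms unfolding regular_at_1_def by (metis poly_0)

lemma regular_at_1_poly [simp]: "regular_at_1 (Fract p 1)"
  and ev1_poly [simp]: "ev1 (Fract p 1) = poly p 1"
  and d1_poly [simp]: "d1 (Fract p 1) = poly (pderiv p) 1"
  using regular_at_1_Fract[of 1 p] ev1_Fract[of 1 p] d1_Fract[of 1 p] by (auto simp: pderiv_1)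

lemma regular_at_1_const [simp]: "regular_at_1 0" "regular_at_1 1"
  and ev1_const [simp]: "ev1 0 = 0" "ev1 1 = 1"
  using regular_at_1_poly[of 0] regular_at_1_poly[of 1] ev1_poly[of 0] ev1_poly[of 1]
  by (simp_all only: Zero_fract_def[symmetric] One_fract_def[symmetric]) auto

lemma
  assumes "regular_at_1 f" "regular_at_1 g"
  shows regular_at_1_add: "regular_at_1 (f + g)" and ev1_add: "ev1 (f + g) = ev1 f + ev1 g"
    and d1_add: "d1 (f + g) = d1 f + d1 g"
    and regular_at_1_mult: "regular_at_1 (f * g)" and ev1_mult: "ev1 (f * g) = ev1 f * ev1 g"
    and d1_mult: "d1 (f * g) = d1 f * ev1 g + ev1 f * d1 g"
proof -
  obtain p d where f: "f = Fract p d" "poly d 1 \<noteq> 0" "d \<noteq> 0" using assms(1) by (rule regular_at_1E)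
  obtain p' d' where g: "g = Fract p' d'" "poly d' 1 \<noteq> 0" "d' \<noteq> 0" using assms(2) by (rule regular_at_1E)
  have nz: "poly (d * d') 1 \<noteq> 0" using f g by simp
  have s: "f + g = Fract (p * d' + p' * d) (d * d')" and m: "f * g = Fract (p * p') (d * d')"
    using f g by simp_all
  show "regular_at_1 (f + g)" "regular_at_1 (f * g)"
    unfolding s m using nz by (simp_all only: regular_at_1_Fract simp_thms)
  show "ev1 (f + g) = ev1 f + ev1 g" "ev1 (f * g) = ev1 f * ev1 g"
    unfolding s m ev1_Fract[OF nz] using f g by (simp_all add: ev1_Fract field_simps)
  show "d1 (f + g) = d1 f + d1 g" "d1 (f * g) = d1 f * ev1 g + ev1 f * d1 g"
    unfolding s m d1_Fract[OF nz] using f g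
    by (simp_all add: d1_Fract ev1_Fract pderiv_mult pderiv_add divide_simps)
      (simp_all add: algebra_simps power2_eq_square)
qed

lemma
  assumes "regular_at_1 f"
  shows regular_at_1_minus: "regular_at_1 (- f)" and ev1_minus: "ev1 (- f) = - ev1 f"
proof -
  obtain p d where f: "f = Fract p d" "poly d 1 \<noteq> 0" "d \<noteq> 0" using assms by (rule regular_at_1E)
  show "regular_at_1 (- f)" "ev1 (- f) = - ev1 f"
    unfolding f(1) minus_fract using f(2)
    by (simp_all add: ev1_Fract regular_at_1_Fract)
qed

lemma
  assumes "regular_at_1 f" "regular_at_1 g"
  shows regular_at_1_diff: "regular_at_1 (f - g)" and ev1_diff: "ev1 (f - g) = ev1 f - ev1 g"
  using assms regular_at_1_add[of f "- g"] ev1_add[of f "- g"]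
  by (simp_all add: regular_at_1_minus ev1_minus)

lemma
  assumes "regular_at_1 f" "ev1 f \<noteq> 0"
  shows regular_at_1_inverse: "regular_at_1 (inverse f)" and ev1_inverse: "ev1 (inverse f) = inverse (ev1 f)"
    and d1_inverse: "d1 (inverse f) = - d1 f / (ev1 f)\<^sup>2"
proof -
  obtain p d where f: "f = Fract p d" "poly d 1 \<noteq> 0" "d \<noteq> 0" using assms(1) by (rule regular_at_1E)
  have p: "poly p 1 \<noteq> 0" using assms(2) f by (auto simp: ev1_Fract)
  show "regular_at_1 (inverse f)" "ev1 (inverse f) = inverse (ev1 f)" 
    unfolding f(1) inverse_fract using p f by (simp_all add: ev1_Fract regular_at_1_Fract)
  show "d1 (inverse f) = - d1 f / (ev1 f)\<^sup>2"
    unfolding f(1) inverse_fract using p f by (simp add: ev1_Fract d1_Fract divide_simps) 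
qed

section \<open>The parameter \<open>t - 1\<close> and the units of value 1\<close>

definition tau :: cf where "tau = Fract [:-1, 1:] 1"

lemma tau_nz: "tau \<noteq> 0"
  unfolding tau_def Zero_fract_def by (simp add: eq_fract)

lemma regular_at_1_tau [simp]: "regular_at_1 tau" and ev1_tau [simp]: "ev1 tau = 0"
  and d1_tau [simp]: "d1 tau = 1"
  unfolding tau_def by (simp_all add: pderiv_pCons)

text \<open>Leibniz rule at 1, where \<open>tau\<close> has value 0 and derivative 1.\<close>

lemma ev1_quotient:
  assumes "f = 1 + tau * c" "regular_at_1 c"
  shows "ev1 c = d1 f"
proof -
  have "d1 (1::cf) = 0" using d1_poly[of 1] by (simp add: One_fract_def pderiv_1)
  then show ?thesis using assms by (simp add: d1_add d1_mult regular_at_1_mult)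
qed

text \<open>The subgroup \<open>1 + m\<close> of the units of the local ring at
  \<open>t = 1\<close>, with \<open>m\<close> its maximal ideal. On it the derivative at 1 is the
  logarithmic derivative, so \<open>d1\<close> turns products into sums.\<close>

definition one_units :: "cf set" where "one_units = {f. regular_at_1 f \<and> ev1 f = 1}"

lemma one_units_nz: "f \<in> one_units \<Longrightarrow> f \<noteq> 0"
  by (auto simp: one_units_def)

lemma one_units_mult: "f \<in> one_units \<Longrightarrow> g \<in> one_units \<Longrightarrow> f * g \<in> one_units \<and> d1 (f * g) = d1 f + d1 g"
  by (auto simp: one_units_def regular_at_1_mult ev1_mult d1_mult)

lemma one_units_inverse: "f \<in> one_units \<Longrightarrow> inverse f \<in> one_units \<and> d1 (inverse f) = - d1 f"
  by (auto simp: one_units_def regular_at_1_inverse ev1_inverse d1_inverse)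

lemma one_units_1: "1 \<in> one_units \<and> d1 1 = 0"
  using ev1_quotient[of 1 0] by (simp add: one_units_def)

lemma one_units_power: "f \<in> one_units \<Longrightarrow> f ^ k \<in> one_units \<and> d1 (f ^ k) = of_nat k * d1 f"
  by (induction k) (auto simp: one_units_1 one_units_mult algebra_simps)

lemma one_units_powi: "f \<in> one_units \<Longrightarrow> f powi k \<in> one_units \<and> d1 (f powi k) = of_int k * d1 f"
  by (cases "k \<ge> 0") (auto simp: power_int_def one_units_power one_units_inverse)

lemma one_units_prod:
  "(\<And>i. i \<in> A \<Longrightarrow> f i \<in> one_units) \<Longrightarrow> (\<Prod>i\<in>A. f i) \<in> one_units \<and> d1 (\<Prod>i\<in>A. f i) = (\<Sum>i\<in>A. d1 (f i))"
  by (induction A rule: infinite_finite_induct) (auto simp: one_units_1 one_units_mult)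

lemma quadratic_interpolation:
  fixes q :: complex
  assumes "q \<noteq> 1"
  shows "poly (e_poly q eta mu) 1 = 1" and "poly (pderiv (e_poly q eta mu)) 1 = mu"
proof -
  let ?P = "\<lambda>p. degree p \<le> 2 \<and> poly p q = eta \<and> poly p 1 = 1 \<and> poly (pderiv p) 1 = mu"
  \<comment> \<open>The conditions at 1 force \<open>1 + mu (t - 1) + c (t - 1)^2\<close>; the value
    at \<open>q\<close> then determines \<open>c\<close>, because \<open>q\<close> differs from 1.
    The polynomial \<open>p0\<close> is this expression expanded in powers of
    \<open>t\<close>.\<close>
  define c where "c = (eta - 1 - mu * (q - 1)) / (q - 1)\<^sup>2"
  define p0 where "p0 = [:1 - mu + c, mu - 2 * c, c:]"
  have "\<exists>!p. ?P p"
  proof (rule ex1I[of _ p0])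
    have "c * (q - 1)\<^sup>2 = eta - 1 - mu * (q - 1)" using assms by (simp add: c_def)
    then show "?P p0" unfolding p0_def
      by (auto simp: degree_pCons_eq_if pderiv_pCons power2_eq_square algebra_simps)
  next
    fix p assume p: "?P p"
    have "degree p \<le> 2" using p by blast
    then have e: "p = [:coeff p 0, coeff p 1, coeff p 2:]"
      by (intro poly_eqI) (auto simp: coeff_pCons numeral_2_eq_2 le_Suc_eq coeff_eq_0 split: nat.split)
    obtain a b d where pe: "p = [:a, b, d:]" using e by blast
    have 1: "a + q * (b + q * d) = eta" "a + b + d = 1" "b + 2 * d = mu"
      using p unfolding pe by (auto simp: pderiv_pCons algebra_simps)
    have "a = 1 - mu + d" "b = mu - 2 * d" using 1 by (auto simp: algebra_simps)
    moreover have "d * (q - 1)\<^sup>2 = eta - 1 - mu * (q - 1)"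
      using 1(1) unfolding calculation by (simp add: power2_eq_square algebra_simps)
    moreover from this have "d = c" using assms by (simp add: c_def nonzero_eq_divide_eq)
    ultimately show "p = p0" unfolding pe p0_def by simp
  qed
  from theI'[OF this] have "?P (e_poly q eta mu)" unfolding e_poly_def .
  then show "poly (e_poly q eta mu) 1 = 1" "poly (pderiv (e_poly q eta mu)) 1 = mu"
    by simp_all
qed

section \<open>The lifted group and its coefficient ring\<close>

lemma prod_powi_add:
  fixes f :: "nat \<Rightarrow> 'a :: field"
  assumes "\<And>i. i \<in> A \<Longrightarrow> f i \<noteq> 0"
  shows "(\<Prod>i\<in>A. f i powi (s i + s' i)) = (\<Prod>i\<in>A. f i powi s i) * (\<Prod>i\<in>A. f i powi s' i)"
  using assms by (simp add: power_int_add prod.distrib[symmetric])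

lemma prod_powi_minus:
  fixes f :: "nat \<Rightarrow> 'a :: field"
  shows "(\<Prod>i\<in>A. f i powi (- s i)) = inverse (\<Prod>i\<in>A. f i powi s i)"
  by (simp add: power_int_minus prod_inversef[symmetric] o_def)

text \<open>The map \<open>c \<mapsto> tilde r eta E c\<close> is only meaningful on the group generated by \<open>eta\<close>, where
  the exponent vector is unique.\<close>

locale free_basis =
  fixes r :: nat and eta mu :: "nat \<Rightarrow> complex" and E :: "nat \<Rightarrow> complex poly"
  assumes eta_nz: "\<And>i. i \<in> {1..r} \<Longrightarrow> eta i \<noteq> 0"
    and free: "\<And>s :: nat \<Rightarrow> int. (\<Prod>i\<in>{1..r}. eta i powi s i) = 1 \<Longrightarrow> \<forall>i\<in>{1..r}. s i = 0"
    and E_1: "\<And>i. poly (E i) 1 = 1"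
    and E_mu: "\<And>i. poly (pderiv (E i)) 1 = mu i"
begin

definition eta_group :: "complex set" where
  "eta_group = {\<Prod>i\<in>{1..r}. eta i powi s i | s :: nat \<Rightarrow> int. True}"

lemma exponents_unique:
  assumes "(\<Prod>i\<in>{1..r}. eta i powi s i) = (\<Prod>i\<in>{1..r}. eta i powi s' i)" and "i \<in> {1..r}"
  shows "s i = s' i"
proof -
  have nz: "(\<Prod>i\<in>{1..r}. eta i powi s' i) \<noteq> 0" using eta_nz by (simp add: power_int_eq_0_iff)
  have "(\<Prod>i\<in>{1..r}. eta i powi (s i + - s' i)) = 1"
    unfolding prod_powi_minus
    by (subst prod_powi_add) (use eta_nz nz assms(1) in \<open>auto simp: prod_powi_minus\<close>)
  then show ?thesis using free[of "\<lambda>i. s i + - s' i"] assms(2) by auto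
qed

lemma tilde_eq:
  assumes "c = (\<Prod>i\<in>{1..r}. eta i powi s i)"
  shows "tilde r eta E c = (\<Prod>i\<in>{1..r}. Fract (E i) 1 powi s i)"
proof -
  \<comment> \<open>The description inside \<open>tilde\<close> ranges over exponent vectors that
    vanish outside \<open>{1..r}\<close>, so \<open>s\<close> has to be truncated before it can be
    the witness.\<close>
  define s0 where "s0 = (\<lambda>i. if i \<in> {1..r} then s i else 0)"
  have "(THE s :: nat \<Rightarrow> int. (\<forall>i. i \<notin> {1..r} \<longrightarrow> s i = 0) \<and> c = (\<Prod>i\<in>{1..r}. eta i powi s i)) = s0"
  proof (rule the_equality)
    show "(\<forall>i. i \<notin> {1..r} \<longrightarrow> s0 i = 0) \<and> c = (\<Prod>i\<in>{1..r}. eta i powi s0 i)"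
      unfolding assms s0_def by auto
  next
    fix s' :: "nat \<Rightarrow> int"
    assume a: "(\<forall>i. i \<notin> {1..r} \<longrightarrow> s' i = 0) \<and> c = (\<Prod>i\<in>{1..r}. eta i powi s' i)"
    then have "i \<in> {1..r} \<Longrightarrow> s' i = s i" for i using exponents_unique[of s' s i] assms by auto
    then show "s' = s0" using a unfolding s0_def by auto
  qed
  then show ?thesis unfolding tilde_def Let_def by (simp add: s0_def)
qed

lemma E_one_unit: "Fract (E i) 1 \<in> one_units"
  unfolding one_units_def by (simp add: E_1)

lemma tilde_one_units:
  assumes "c = (\<Prod>i\<in>{1..r}. eta i powi s i)"
  shows "tilde r eta E c \<in> one_units" and "d1 (tilde r eta E c) = (\<Sum>i\<in>{1..r}. of_int (s i) * mu i)"
  using one_units_prod[of "{1..r}" "\<lambda>i. Fract (E i) 1 powi s i"]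
    one_units_powi[OF E_one_unit] unfolding tilde_eq[OF assms] by (auto simp: E_mu)

lemma tilde_inverse:
  assumes "c \<in> eta_group"
  shows "tilde r eta E (inverse c) = inverse (tilde r eta E c)"
proof -
  obtain s where s: "c = (\<Prod>i\<in>{1..r}. eta i powi s i)" using assms unfolding eta_group_def by blast
  then have "inverse c = (\<Prod>i\<in>{1..r}. eta i powi (- s i))" by (simp only: prod_powi_minus)
  from tilde_eq[OF this] show ?thesis by (simp only: tilde_eq[OF s] prod_powi_minus)
qed

text \<open>The derivative is the combination of the \<open>mu i\<close> with the exponents of
  \<open>c\<close> as coefficients. If it is 0, rational independence makes all exponents 0, and
  \<open>c\<close> is 1.\<close>

lemma d1_tilde_nz:
  assumes indep: "\<forall>c :: nat \<Rightarrow> rat. (\<Sum>i\<in>{1..r}. of_rat (c i) * mu i) = 0 \<longrightarrow> (\<forall>i\<in>{1..r}. c i = 0)"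
    and c: "c \<in> eta_group" "c \<noteq> 1"
  shows "d1 (tilde r eta E c) \<noteq> 0"
proof
  assume 0: "d1 (tilde r eta E c) = 0"
  obtain s where s: "c = (\<Prod>i\<in>{1..r}. eta i powi s i)" using c unfolding eta_group_def by blast
  have "(\<Sum>i\<in>{1..r}. of_rat (of_int (s i)) * mu i) = 0"
    using 0 tilde_one_units(2)[OF s] by (simp add: of_rat_of_int_eq)
  then have "\<forall>i\<in>{1..r}. s i = 0" using indep[rule_format, of "\<lambda>i. of_int (s i)"] by simp
  then show False using s c(2) by simp
qed

section \<open>The localised coefficient ring\<close>

abbreviation "FF \<equiv> Fset r E"

lemma FsetI: "Fract p (monom 1 a * (\<Prod>i\<in>{1..r}. E i ^ k i)) \<in> FF"
  unfolding Fset_def by blast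

text \<open>\<open>t\<close> and all \<open>E i\<close> have value 1 at \<open>t = 1\<close>, so
  inverting them stays inside the local ring at 1.\<close>

lemma Fset_denom: "poly (monom 1 a * (\<Prod>i\<in>{1..r}. E i ^ k i)) 1 = 1"
  by (simp add: poly_monom poly_prod E_1)

lemma Fset_denom_nz: "monom 1 a * (\<Prod>i\<in>{1..r}. E i ^ k i) \<noteq> 0"
  using Fset_denom[of a k] by (metis poly_0 zero_neq_one)

lemma FsetE:
  assumes "f \<in> FF"
  obtains p a k where "f = Fract p (monom 1 a * (\<Prod>i\<in>{1..r}. E i ^ k i))"
  using assms unfolding Fset_def by blast

lemma Fset_poly: "Fract p 1 \<in> FF"
  using FsetI[of p 0 "\<lambda>_. 0"] by simp

lemma Fset_mult_denom:
  "monom 1 a * (\<Prod>i\<in>{1..r}. E i ^ k i) * (monom 1 b * (\<Prod>i\<in>{1..r}. E i ^ l i))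
   = (monom 1 (a + b) * (\<Prod>i\<in>{1..r}. E i ^ (k i + l i)) :: complex poly)"
proof -
  have "monom 1 (a + b) = (monom 1 a * monom 1 b :: complex poly)" by (simp add: mult_monom)
  then show ?thesis by (simp only: power_add prod.distrib mult_ac)
qed

lemma Fset_add: "f \<in> FF \<Longrightarrow> g \<in> FF \<Longrightarrow> f + g \<in> FF"
  by (elim FsetE) (simp only: add_fract[OF Fset_denom_nz Fset_denom_nz] Fset_mult_denom FsetI)

lemma Fset_mult: "f \<in> FF \<Longrightarrow> g \<in> FF \<Longrightarrow> f * g \<in> FF"
  by (elim FsetE) (simp only: mult_fract Fset_mult_denom FsetI)

lemma Fset_minus: "f \<in> FF \<Longrightarrow> - f \<in> FF"
  by (elim FsetE) (simp only: minus_fract FsetI)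

lemma Fset_regular: "f \<in> FF \<Longrightarrow> regular_at_1 f"
  by (elim FsetE) (simp only: regular_at_1_Fract[of "monom 1 a * b" for a b] Fset_denom one_neq_zero not_False_eq_True)

text \<open>The denominator does not vanish at 1, so \<open>t - 1\<close> divides the numerator; the
  quotient keeps its denominator and hence stays in \<open>FF\<close>.\<close>

lemma Fset_divide_tau:
  assumes "f \<in> FF" "ev1 f = 0"
  shows "\<exists>c\<in>FF. f = tau * c"
proof -
  obtain p a k where f: "f = Fract p (monom 1 a * (\<Prod>i\<in>{1..r}. E i ^ k i))" using assms(1) by (rule FsetE)
  have "poly p 1 = 0" using assms(2) unfolding f by (subst (asm) ev1_Fract) (simp_all only: Fset_denom, auto)
  then have "[:-1, 1:] dvd p" using poly_eq_0_iff_dvd by blast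
  then obtain p' where "p = [:-1, 1:] * p'" by (rule dvdE)
  then have "f = tau * Fract p' (monom 1 a * (\<Prod>i\<in>{1..r}. E i ^ k i))"
    unfolding f tau_def by (simp only: mult_fract mult_1)
  then show ?thesis using FsetI by blast
qed

lemma Fset_E_powi:
  assumes "i \<in> {1..r}"
  shows "Fract (E i) 1 powi m \<in> FF"
proof -
  have pow: "Fract p p' ^ n = Fract (p ^ n) (p' ^ n)" for p p' :: "complex poly" and n
    by (induction n) (auto simp: One_fract_def)
  show ?thesis
  proof (cases "m \<ge> 0")
    case True
    then show ?thesis by (simp add: power_int_def pow Fset_poly)
  next
    case False
    \<comment> \<open>A negative power of \<open>E i\<close> needs a denominator of the prescribed
      shape: exponent \<open>- m\<close> at \<open>i\<close>, and 0 at every other index.\<close>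
    have "(\<Prod>j\<in>{1..r}. E j ^ (if j = i then nat (- m) else 0)) = (\<Prod>j\<in>{1..r}. if j = i then E j ^ nat (- m) else 1)"
      by (rule prod.cong) auto
    also have "\<dots> = E i ^ nat (- m)" using assms by (subst prod.delta) auto
    finally show ?thesis using FsetI[of 1 0 "\<lambda>j. if j = i then nat (- m) else 0"] False
      by (simp add: power_int_def power_inverse pow)
  qed
qed

lemma Fset_prod: "(\<And>i. i \<in> A \<Longrightarrow> f i \<in> FF) \<Longrightarrow> (\<Prod>i\<in>A. f i) \<in> FF"
  by (induction A rule: infinite_finite_induct)
    (auto simp: Fset_mult intro: Fset_poly[of 1, folded One_fract_def])

lemma tilde_in_Fset: "c \<in> eta_group \<Longrightarrow> tilde r eta E c \<in> FF"
  unfolding eta_group_def by (auto simp: tilde_eq intro!: Fset_prod Fset_E_powi simp del: atLeastAtMost_iff)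

end

section \<open>The free algebra and its modules\<close>

definition conv :: "fa \<Rightarrow> fa \<Rightarrow> fa" where
  "conv f g = (\<lambda>w. \<Sum>k\<le>length w. f (take k w) * g (drop k w))"

definition supp :: "fa \<Rightarrow> nat list set" where "supp f = {w. f w \<noteq> 0}"

definition wmono :: "cf \<Rightarrow> nat list \<Rightarrow> fa" where "wmono c u = (\<lambda>w. if w = u then c else 0)"

lemma mult_FA [simp]: "f \<otimes>\<^bsub>FA S V\<^esub> g = conv f g"
  and one_FA [simp]: "\<one>\<^bsub>FA S V\<^esub> = wmono 1 []"
  and zero_FA [simp]: "\<zero>\<^bsub>FA S V\<^esub> = 0"
  and add_FA [simp]: "f \<oplus>\<^bsub>FA S V\<^esub> g = f + g"
  and carrier_FA: "f \<in> carrier (FA S V) \<longleftrightarrow>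
    finite (supp f) \<and> (\<forall>w. f w \<in> S) \<and> (\<forall>w. f w \<noteq> 0 \<longrightarrow> set w \<subseteq> V)"
  by (auto simp: FA_def conv_def wmono_def supp_def fun_eq_iff)

lemma sc_mono: "sc c = wmono c []" and gen_mono: "gen k = wmono 1 [k]"
  by (simp_all add: sc_def gen_def wmono_def)

lemma splits_eq: "{(u, v). u @ v = w} = (\<lambda>k. (take k w, drop k w)) ` {..length w}"
proof (intro subset_antisym subsetI)
  fix p assume "p \<in> {(u, v). u @ v = w}"
  then have "p = (take (length (fst p)) w, drop (length (fst p)) w)" "length (fst p) \<le> length w" by auto
  then show "p \<in> (\<lambda>k. (take k w, drop k w)) ` {..length w}" by blast
qed auto

lemma finite_splits: "finite {(u, v). u @ v = w}"
  unfolding splits_eq by simp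

lemma sum_splits:
  fixes F :: "'a list \<times> 'a list \<Rightarrow> 'b :: comm_monoid_add"
  shows "(\<Sum>k\<le>length w. F (take k w, drop k w)) = (\<Sum>p\<in>{(u, v). u @ v = w}. F p)"
proof -
  have inj: "inj_on (\<lambda>k. (take k w, drop k w)) {..length w}"
    by (rule inj_onI) (metis Pair_inject atMost_iff length_take min.absorb2)
  show ?thesis unfolding splits_eq by (subst sum.reindex[OF inj]) (simp add: o_def)
qed

lemma conv_eq_sum_splits: "conv f g w = (\<Sum>(u, v)\<in>{(u, v). u @ v = w}. f u * g v)"
  unfolding conv_def by (subst sum_splits[symmetric]) simp

text \<open>Sums over cuts of \<open>w\<close> become sums over pairs of words from finite sets that
  contain the supports. In this form the product can be regrouped in
  \<open>act_conv\<close>.\<close>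

lemma conv_eq_sum_pairs:
  assumes "finite A" "finite B" "supp f \<subseteq> A" "supp g \<subseteq> B"
  shows "conv f g w = (\<Sum>(u, v)\<in>{p \<in> A \<times> B. fst p @ snd p = w}. f u * g v)"
  unfolding conv_eq_sum_splits
  by (rule sum.mono_neutral_right) (use assms finite_splits in \<open>auto simp: supp_def\<close>)

lemma conv_neq_0: "conv f g w \<noteq> 0 \<Longrightarrow> \<exists>u v. w = u @ v \<and> f u \<noteq> 0 \<and> g v \<noteq> 0"
  unfolding conv_def by (metis (no_types, lifting) append_take_drop_id mult_not_zero sum.neutral)

lemma supp_conv: "supp (conv f g) \<subseteq> (\<lambda>(u, v). u @ v) ` (supp f \<times> supp g)"
  by (force simp: supp_def dest: conv_neq_0)

lemma supp_mono: "supp (wmono c u) \<subseteq> {u}" by (auto simp: supp_def wmono_def)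

lemma conv_mono_mono: "conv (wmono c u) (wmono d v) = wmono (c * d) (u @ v)"
proof
  fix w
  show "conv (wmono c u) (wmono d v) w = wmono (c * d) (u @ v) w"
    unfolding conv_eq_sum_pairs[of "{u}" "{v}", OF _ _ supp_mono supp_mono, simplified]
    by (cases "u @ v = w") (auto simp: wmono_def Collect_conv_if cong: conj_cong)
qed

lemma conv_scalar_left: "conv (wmono c []) f = (\<lambda>w. c * f w)"
proof
  fix w
  have "conv (wmono c []) f w = (\<Sum>k\<in>{0}. wmono c [] (take k w) * f (drop k w))"
    unfolding conv_def by (rule sum.mono_neutral_right) (auto simp: wmono_def)
  then show "conv (wmono c []) f w = c * f w" by (simp add: wmono_def)
qed

lemma conv_scalar_right: "conv f (wmono c []) = (\<lambda>w. c * f w)"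
proof
  fix w
  have "conv f (wmono c []) w = (\<Sum>k\<in>{length w}. f (take k w) * wmono c [] (drop k w))"
    unfolding conv_def by (rule sum.mono_neutral_right) (auto simp: wmono_def)
  then show "conv f (wmono c []) w = c * f w" by (simp add: wmono_def)
qed

lemma conv_add_left: "conv (f + g) h = conv f h + conv g h"
  and conv_add_right: "conv h (f + g) = conv h f + conv h g"
  by (simp_all add: conv_def fun_eq_iff sum.distrib[symmetric] sum_negf algebra_simps)

text \<open>Both sides sum over the ways to cut \<open>w\<close> into three pieces. The change of
  indices is the one behind associativity of power series multiplication.\<close>

lemma conv_assoc: "conv (conv f g) h = conv f (conv g h)"
proof
  fix w :: "nat list"
  let ?n = "length w"
  let ?F = "\<lambda>i a b. f (take i w) * g (take a (drop i w)) * h (drop (i + a) w)"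
  have "conv (conv f g) h w = (\<Sum>j=0..?n. \<Sum>i=0..j. ?F i (j - i) (?n - j))"
    unfolding conv_def atLeast0AtMost
    by (intro sum.cong refl) (auto simp: sum_distrib_right take_drop min_def intro!: sum.cong)
  also have "\<dots> = (\<Sum>j=0..?n. \<Sum>i=0..?n - j. ?F j i (?n - j - i))"
    by (rule fps_mult_assoc_lemma)
  also have "\<dots> = conv f (conv g h) w"
    unfolding conv_def atLeast0AtMost
    by (intro sum.cong refl) (auto simp: sum_distrib_left mult.assoc add.commute intro!: sum.cong)
  finally show "conv (conv f g) h w = conv f (conv g h) w" .
qed

locale coeff_ring =
  fixes S :: "cf set" and V :: "nat set"
  assumes S_0: "0 \<in> S" and S_1: "1 \<in> S"
    and S_add: "\<And>a b. a \<in> S \<Longrightarrow> b \<in> S \<Longrightarrow> a + b \<in> S"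
    and S_mult: "\<And>a b. a \<in> S \<Longrightarrow> b \<in> S \<Longrightarrow> a * b \<in> S"
    and S_minus: "\<And>a. a \<in> S \<Longrightarrow> - a \<in> S"
begin

abbreviation "R \<equiv> FA S V"

lemma S_sum: "(\<And>i. i \<in> A \<Longrightarrow> f i \<in> S) \<Longrightarrow> sum f A \<in> S"
  by (induction A rule: infinite_finite_induct) (auto simp: S_0 S_add)

lemma conv_closed [intro]:
  assumes "f \<in> carrier R" "g \<in> carrier R"
  shows "conv f g \<in> carrier R"
  unfolding carrier_FA
proof (intro conjI allI impI)
  show "finite (supp (conv f g))"
    by (rule finite_subset[OF supp_conv]) (use assms in \<open>auto simp: carrier_FA\<close>)
  show "conv f g w \<in> S" for w
    unfolding conv_def by (rule S_sum) (use assms in \<open>auto simp: carrier_FA S_mult\<close>)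
  show "set w \<subseteq> V" if "conv f g w \<noteq> 0" for w
    using conv_neq_0[OF that] assms by (fastforce simp: carrier_FA)
qed

lemma add_closed [intro]:
  assumes "f \<in> carrier R" "g \<in> carrier R"
  shows "f + g \<in> carrier R"
proof -
  have "supp (f + g) \<subseteq> supp f \<union> supp g" by (auto simp: supp_def)
  then show ?thesis using assms by (auto simp: carrier_FA S_add intro: finite_subset) (metis add.right_neutral add_cancel_right_left subsetD)
qed

lemma uminus_closed [intro]: "f \<in> carrier R \<Longrightarrow> - f \<in> carrier R"
  by (auto simp: carrier_FA supp_def S_minus)

lemma zero_closed [intro]: "0 \<in> carrier R"
  by (auto simp: carrier_FA supp_def S_0)

lemma mono_closed [intro]: "c \<in> S \<Longrightarrow> set w \<subseteq> V \<Longrightarrow> wmono c w \<in> carrier R"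
  using finite_subset[OF supp_mono[of c w]] by (auto simp: carrier_FA wmono_def S_0)

lemma ring_FA: "ring R"
proof (rule ringI)
  show "abelian_group R"
    by (rule abelian_groupI) (auto simp: add_ac intro: bexI[of _ "- x" for x])
  show "Group.monoid R"
    by (rule monoidI) (auto simp: conv_assoc conv_scalar_left conv_scalar_right S_1)
qed (auto simp: conv_add_left conv_add_right)

sublocale FA: ring R by (rule ring_FA)

lemma a_inv_FA: "f \<in> carrier R \<Longrightarrow> \<ominus>\<^bsub>R\<^esub> f = - f"
  by (rule FA.minus_equality) auto

lemma minus_FA: "f \<in> carrier R \<Longrightarrow> g \<in> carrier R \<Longrightarrow> f \<ominus>\<^bsub>R\<^esub> g = f - g"
  by (simp add: a_minus_def a_inv_FA)

lemma minus_closed [intro]: "f \<in> carrier R \<Longrightarrow> g \<in> carrier R \<Longrightarrow> f - g \<in> carrier R"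
  using add_closed[of f "- g"] uminus_closed[of g] by simp

lemma sum_closed: "(\<And>i. i \<in> A \<Longrightarrow> f i \<in> carrier R) \<Longrightarrow> sum f A \<in> carrier R"
  by (induction A rule: infinite_finite_induct) auto

lemma finsum_FA: "finite A \<Longrightarrow> (\<And>i. i \<in> A \<Longrightarrow> f i \<in> carrier R) \<Longrightarrow> finsum R f A = sum f A"
  by (induction A rule: finite_induct) (auto simp: FA.finsum_insert Pi_def)

end

text \<open>A module over the free algebra, given by scalars and letters; a word acts as the
  composite of its letters, the first one outermost. It serves twice: on polynomials, where it
  defines \<open>Phi\<close>, and on the weight modules.\<close>

locale free_action = coeff_ring +
  fixes \<sigma> :: "cf \<Rightarrow> 'm :: ab_group_add \<Rightarrow> 'm" and \<theta> :: "nat \<Rightarrow> 'm \<Rightarrow> 'm"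
  assumes \<sigma>_add: "\<And>a b m. a \<in> S \<Longrightarrow> b \<in> S \<Longrightarrow> \<sigma> (a + b) m = \<sigma> a m + \<sigma> b m"
    and \<sigma>_mult: "\<And>a b m. a \<in> S \<Longrightarrow> b \<in> S \<Longrightarrow> \<sigma> (a * b) m = \<sigma> a (\<sigma> b m)"
    and \<sigma>_1: "\<And>m. \<sigma> 1 m = m"
    and \<sigma>_plus: "\<And>a m m'. a \<in> S \<Longrightarrow> \<sigma> a (m + m') = \<sigma> a m + \<sigma> a m'"
    and \<theta>_plus: "\<And>k m m'. \<theta> k (m + m') = \<theta> k m + \<theta> k m'"
    and \<theta>_\<sigma>: "\<And>k a m. a \<in> S \<Longrightarrow> \<theta> k (\<sigma> a m) = \<sigma> a (\<theta> k m)"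
begin

lemma \<sigma>_0 [simp]: "\<sigma> 0 m = 0"
  using \<sigma>_add[OF S_0 S_0] by simp

lemma \<sigma>_zero [simp]: "a \<in> S \<Longrightarrow> \<sigma> a 0 = 0"
  using \<sigma>_plus[of a 0 0] by simp

lemma \<theta>_zero: "\<theta> k 0 = 0"
  using \<theta>_plus[of k 0 0] by simp

lemma word_plus: "foldr \<theta> w (m + m') = foldr \<theta> w m + foldr \<theta> w m'"
  by (induction w) (auto simp: \<theta>_plus)

lemma word_zero: "foldr \<theta> w 0 = 0"
  by (induction w) (auto simp: \<theta>_zero)

lemma word_\<sigma>: "a \<in> S \<Longrightarrow> foldr \<theta> w (\<sigma> a m) = \<sigma> a (foldr \<theta> w m)"
  by (induction w) (auto simp: \<theta>_\<sigma>)

lemma word_sum: "foldr \<theta> w (sum f A) = (\<Sum>i\<in>A. foldr \<theta> w (f i))"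
  by (induction A rule: infinite_finite_induct) (auto simp: word_plus word_zero)

lemma \<sigma>_sum_arg: "a \<in> S \<Longrightarrow> \<sigma> a (sum f A) = (\<Sum>i\<in>A. \<sigma> a (f i))"
  by (induction A rule: infinite_finite_induct) (auto simp: \<sigma>_plus)

lemma \<sigma>_sum: "(\<And>i. i \<in> A \<Longrightarrow> f i \<in> S) \<Longrightarrow> \<sigma> (sum f A) m = (\<Sum>i\<in>A. \<sigma> (f i) m)"
  by (induction A rule: infinite_finite_induct) (auto simp: \<sigma>_add S_sum)

definition act :: "fa \<Rightarrow> 'm \<Rightarrow> 'm" where
  "act f m = (\<Sum>w\<in>supp f. \<sigma> (f w) (foldr \<theta> w m))"

lemma act_superset:
  assumes "finite A" "supp f \<subseteq> A"
  shows "act f m = (\<Sum>w\<in>A. \<sigma> (f w) (foldr \<theta> w m))"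
  unfolding act_def by (rule sum.mono_neutral_left) (use assms in \<open>auto simp: supp_def\<close>)

lemma act_add:
  assumes "f \<in> carrier R" "g \<in> carrier R"
  shows "act (f + g) m = act f m + act g m"
proof -
  have fin: "finite (supp f \<union> supp g)" using assms by (simp add: carrier_FA)
  have "supp (f + g) \<subseteq> supp f \<union> supp g" by (auto simp: supp_def)
  note act_superset[OF fin this] act_superset[OF fin, of f] act_superset[OF fin, of g]
  then show ?thesis using assms by (simp add: carrier_FA \<sigma>_add sum.distrib)
qed

lemma act_zero: "act 0 m = 0"
  by (simp add: act_def supp_def)

lemma act_minus: "f \<in> carrier R \<Longrightarrow> act (- f) m = - act f m"
  using act_add[of f "- f" m] uminus_closed[of f] by (simp add: act_zero eq_neg_iff_add_eq_0 add.commute)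

lemma act_diff: "f \<in> carrier R \<Longrightarrow> g \<in> carrier R \<Longrightarrow> act (f - g) m = act f m - act g m"
  using act_add[of f "- g" m] uminus_closed[of g] by (simp add: act_minus)

lemma act_sum:
  "(\<And>i. i \<in> A \<Longrightarrow> f i \<in> carrier R) \<Longrightarrow> act (sum f A) m = (\<Sum>i\<in>A. act (f i) m)"
  by (induction A rule: infinite_finite_induct) (auto simp: act_zero act_add sum_closed)

lemma act_wmono: "c \<in> S \<Longrightarrow> act (wmono c w) m = \<sigma> c (foldr \<theta> w m)"
  using act_superset[OF _ supp_mono[of c w], of m] by (simp add: wmono_def)

text \<open>Concatenated words act by composition, and letters commute with scalars. After the pairs
  of support words are regrouped by their concatenation, the sum factors through
  \<open>act g m\<close>.\<close>

lemma act_conv: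
  assumes f: "f \<in> carrier R" and g: "g \<in> carrier R"
  shows "act (conv f g) m = act f (act g m)"
proof -
  let ?P = "supp f \<times> supp g"
  let ?W = "(\<lambda>(u, v). u @ v) ` ?P"
  have fin: "finite (supp f)" "finite (supp g)" and S: "\<And>w. f w \<in> S" "\<And>w. g w \<in> S"
    using f g by (auto simp: carrier_FA)
  have "act (conv f g) m = (\<Sum>w\<in>?W. \<sigma> (conv f g w) (foldr \<theta> w m))"
    by (rule act_superset) (use fin supp_conv in auto)
  also have "\<dots> = (\<Sum>w\<in>?W. \<Sum>p | p \<in> ?P \<and> fst p @ snd p = w.
      \<sigma> (f (fst p)) (\<sigma> (g (snd p)) (foldr \<theta> (fst p @ snd p) m)))"
  proof (rule sum.cong[OF refl])
    fix w
    have "\<sigma> (conv f g w) m' = (\<Sum>p | p \<in> ?P \<and> fst p @ snd p = w. \<sigma> (f (fst p)) (\<sigma> (g (snd p)) m'))" for m'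
      unfolding conv_eq_sum_pairs[OF fin order_refl order_refl]
      by (subst \<sigma>_sum) (auto simp: S S_mult \<sigma>_mult split_beta)
    then show "\<sigma> (conv f g w) (foldr \<theta> w m) = (\<Sum>p | p \<in> ?P \<and> fst p @ snd p = w.
      \<sigma> (f (fst p)) (\<sigma> (g (snd p)) (foldr \<theta> (fst p @ snd p) m)))"
      by (auto intro!: sum.cong)
  qed
  also have "\<dots> = (\<Sum>p\<in>?P. \<sigma> (f (fst p)) (\<sigma> (g (snd p)) (foldr \<theta> (fst p @ snd p) m)))"
    by (rule sum.group) (use fin in auto)
  also have "\<dots> = (\<Sum>u\<in>supp f. \<Sum>v\<in>supp g. \<sigma> (f u) (\<sigma> (g v) (foldr \<theta> (u @ v) m)))"
    by (simp add: sum.cartesian_product split_beta)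
  also have "\<dots> = act f (act g m)"
    unfolding act_def by (simp add: word_sum word_\<sigma> \<sigma>_sum_arg S)
  finally show ?thesis .
qed

lemma act_arg_zero: "f \<in> carrier R \<Longrightarrow> act f 0 = 0"
  unfolding act_def by (rule sum.neutral) (auto simp: word_zero carrier_FA)

text \<open>Quantifying over all vectors makes the annihilator two-sided: a product
  \<open>f g\<close> kills \<open>m\<close> because \<open>f\<close> kills
  \<open>act g m\<close>.\<close>

lemma ideal_annihilator: "ideal {f \<in> carrier R. \<forall>m. act f m = 0} R"
proof (rule idealI[OF ring_FA])
  have inv: "inv\<^bsub>add_monoid R\<^esub> f = - f" if "f \<in> carrier R" for f
    using a_inv_FA[OF that] by (simp add: a_inv_def)
  show "subgroup {f \<in> carrier R. \<forall>m. act f m = 0} (add_monoid R)"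
    by (rule subgroup.intro) (auto simp: act_add act_zero act_minus inv[simplified])
qed (auto simp: act_conv act_arg_zero)

lemma genideal_annihilated:
  assumes "X \<subseteq> carrier R" "\<And>x m. x \<in> X \<Longrightarrow> act x m = 0" "f \<in> genideal R X"
  shows "act f m = 0"
  using FA.genideal_minimal[OF ideal_annihilator, of X] assms by auto

end

section \<open>Specialisation to commuting variables\<close>

fun wexp :: "nat list \<Rightarrow> nat \<Rightarrow>\<^sub>0 nat" where
  "wexp [] = 0"
| "wexp (k # w) = Poly_Mapping.single k 1 + wexp w"

lemma lookup_wexp: "Poly_Mapping.lookup (wexp w) k = count (mset w) k"
  by (induction w) (auto simp: lookup_add lookup_single when_def)

text \<open>Connects the two forms of a commutative monomial: exponent vectors in the target of
  \<open>Phi\<close>, and words up to rearrangement in \<open>A_1\<close>.\<close>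

lemma wexp_eq_iff: "wexp u = wexp v \<longleftrightarrow> mset u = mset v"
  by (simp add: poly_mapping_eq_iff fun_eq_iff lookup_wexp multiset_eq_iff)

lemma keys_wexp: "Poly_Mapping.keys (wexp w) = set w"
  by (auto simp: in_keys_iff lookup_wexp) 

lemma wexp_surj: "\<exists>w. wexp w = m"
proof -
  obtain w where w: "mset w = Abs_multiset (Poly_Mapping.lookup m)" using ex_mset by blast
  have "wexp w = m"
    by (rule poly_mapping_eqI) (simp add: lookup_wexp w count_Abs_multiset)
  then show ?thesis by blast
qed

lemma ev1_cst [simp]: "ev1 (cst z) = z" by (simp add: cst_def)

lemma pconst_add: "pconst (a + b) = pconst a + pconst b" by (simp add: pconst_def single_add)
lemma pconst_mult: "pconst (a * b) = pconst a * pconst b" by (simp add: pconst_def mult_single)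
lemma pconst_1: "pconst 1 = 1" by (simp add: pconst_def)
lemma pconst_mult_single: "pconst a * Poly_Mapping.single m b = Poly_Mapping.single m (a * b)"
  by (simp add: pconst_def mult_single)

locale regular_coeff_ring = coeff_ring +
  assumes S_regular: "\<And>a. a \<in> S \<Longrightarrow> regular_at_1 a"
    and S_cst: "\<And>z. cst z \<in> S"
begin

text \<open>The polynomial ring as a module over the free algebra. \<open>Phi f\<close> is the image
  of the vector 1, and multiplicativity of \<open>Phi\<close> is inherited from
  \<open>act_conv\<close>.\<close>

sublocale spec: free_action S V "\<lambda>c p. pconst (ev1 c) * p" "\<lambda>k p. pvar k * p"
  by unfold_locales (auto simp: ev1_add ev1_mult S_regular pconst_add pconst_mult pconst_1 algebra_simps)

definition Phi :: "fa \<Rightarrow> cpoly" where "Phi f = spec.act f 1"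

lemma word_spec: "foldr (\<lambda>k p. pvar k * p) w p = Poly_Mapping.single (wexp w) 1 * p"
  by (induction w) (auto simp: pvar_def mult_single mult.assoc[symmetric])

lemma act_spec: "spec.act f p = Phi f * p"
  by (simp add: Phi_def spec.act_def sum_distrib_right word_spec mult.assoc)

lemma Phi_conv: "f \<in> carrier R \<Longrightarrow> g \<in> carrier R \<Longrightarrow> Phi (conv f g) = Phi f * Phi g"
  using spec.act_conv[of f g 1] by (simp add: act_spec)

lemma Phi_add: "f \<in> carrier R \<Longrightarrow> g \<in> carrier R \<Longrightarrow> Phi (f + g) = Phi f + Phi g"
  and Phi_diff: "f \<in> carrier R \<Longrightarrow> g \<in> carrier R \<Longrightarrow> Phi (f - g) = Phi f - Phi g"
  and Phi_sum: "(\<And>i. i \<in> A \<Longrightarrow> F i \<in> carrier R) \<Longrightarrow> Phi (sum F A) = (\<Sum>i\<in>A. Phi (F i))"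
  by (simp_all add: Phi_def spec.act_add spec.act_diff spec.act_sum)

lemma Phi_wmono: "c \<in> S \<Longrightarrow> Phi (wmono c w) = Poly_Mapping.single (wexp w) (ev1 c)"
  by (simp add: Phi_def spec.act_wmono word_spec pconst_mult_single)

lemma Phi_sc: "c \<in> S \<Longrightarrow> Phi (sc c) = pconst (ev1 c)"
  by (simp add: sc_mono Phi_wmono pconst_def)

lemma Phi_gen: "Phi (gen k) = pvar k"
  by (simp add: gen_mono Phi_wmono S_1 pvar_def)

lemma lookup_Phi:
  assumes "finite A" "supp f \<subseteq> A"
  shows "Poly_Mapping.lookup (Phi f) m = (\<Sum>w | w \<in> A \<and> wexp w = m. ev1 (f w))"
  unfolding Phi_def spec.act_superset[OF assms]
  using assms(1) by (simp add: word_spec pconst_mult_single lookup_sum lookup_single when_def sum.If_cases Int_def)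

lemma Phi_closed: 
  assumes "f \<in> carrier R"
  shows "Phi f \<in> carrier (PR V)"
proof -
  have "Poly_Mapping.keys m \<subseteq> V" if "m \<in> Poly_Mapping.keys (Phi f)" for m
  proof -
    have "(\<Sum>w | w \<in> supp f \<and> wexp w = m. ev1 (f w)) \<noteq> 0"
      using that assms lookup_Phi[of "supp f" f m] by (simp add: in_keys_iff carrier_FA)
    then obtain w where "w \<in> supp f" "wexp w = m"
      by (rule sum.not_neutral_contains_not_neutral) blast
    then show ?thesis using assms unfolding carrier_FA supp_def by (metis keys_wexp mem_Collect_eq)
  qed
  then show ?thesis by (simp add: PR_def)
qed

lemma Phi_hom: "Phi \<in> ring_hom R (PR V)"
  by (rule ring_hom_memI)
    (auto simp: Phi_closed Phi_conv Phi_add Phi_wmono S_1, auto simp: PR_def Phi_conv Phi_add)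

lemma Phi_surj:
  assumes "p \<in> carrier (PR V)"
  shows "\<exists>f\<in>carrier R. Phi f = p"
proof -
  obtain word where word: "\<And>m. wexp (word m) = m" using wexp_surj by metis
  define F where "F = (\<lambda>m. wmono (cst (Poly_Mapping.lookup p m)) (word m))"
  have F: "F m \<in> carrier R" if "m \<in> Poly_Mapping.keys p" for m
    using assms that word keys_wexp[of "word m"] by (auto simp: F_def S_cst PR_def intro!: mono_closed)
  have "Phi (sum F (Poly_Mapping.keys p)) = (\<Sum>m\<in>Poly_Mapping.keys p. Poly_Mapping.single m (Poly_Mapping.lookup p m))"
    by (subst Phi_sum) (use F in \<open>auto simp: F_def Phi_wmono S_cst word\<close>)
  also have "\<dots> = p"
    by (rule poly_mapping_eqI) (auto simp: lookup_sum lookup_single when_def in_keys_iff)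
  finally show ?thesis using sum_closed[of "Poly_Mapping.keys p" F] F by blast
qed

end

text \<open>Induction on the variables: freezing all but one at nonzero values gives a polynomial in
  one variable with infinitely many roots. Each of its coefficients is an identity in the remaining
  variables, indexed by the terms with one fixed exponent of \<open>v\<close>.\<close>

lemma polynomial_identity:
  fixes c :: "'b \<Rightarrow> complex" and e :: "'b \<Rightarrow> 'i \<Rightarrow> nat"
  assumes "finite V" "finite B"
    and "\<And>b b'. b \<in> B \<Longrightarrow> b' \<in> B \<Longrightarrow> \<forall>i\<in>V. e b i = e b' i \<Longrightarrow> b = b'"
    and "\<And>x. \<forall>i\<in>V. x i \<noteq> 0 \<Longrightarrow> (\<Sum>b\<in>B. c b * (\<Prod>i\<in>V. x i ^ e b i)) = 0"
  shows "\<forall>b\<in>B. c b = 0"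
  using assms
proof (induction V arbitrary: B rule: finite_induct)
  case empty
  show ?case
  proof
    fix b assume b: "b \<in> B"
    then have "B = {b}" using empty(2) by blast
    then show "c b = 0" using empty(3)[of "\<lambda>_. 1"] by simp
  qed
next
  case (insert v V)
  show ?case
  proof
    fix b0 assume b0: "b0 \<in> B"
    let ?B = "{b \<in> B. e b v = e b0 v}"
    have "\<forall>b\<in>?B. c b = 0"
    proof (rule insert.IH)
      show "finite ?B" using insert.prems by simp
      show "b = b'" if "b \<in> ?B" "b' \<in> ?B" "\<forall>i\<in>V. e b i = e b' i" for b b'
        using insert.prems(2)[of b b'] that by simp
      fix x :: "'i \<Rightarrow> complex" assume x: "\<forall>i\<in>V. x i \<noteq> 0"
      \<comment> \<open>The sum as a polynomial in the variable \<open>v\<close>; its coefficient at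
        \<open>e b0 v\<close> is the sum over \<open>?B\<close>.\<close>
      define p where "p = (\<Sum>b\<in>B. monom (c b * (\<Prod>i\<in>V. x i ^ e b i)) (e b v))"
      have "poly p z = 0" if "z \<noteq> 0" for z
      proof -
        have "(\<Prod>i\<in>V. (x(v := z)) i ^ e b i) = (\<Prod>i\<in>V. x i ^ e b i)" for b
          using insert.hyps by (intro prod.cong) auto
        moreover have "\<forall>i\<in>insert v V. (x(v := z)) i \<noteq> 0" using x that by simp
        ultimately show ?thesis
          using insert.prems(3)[of "x(v := z)"] insert.hyps
          by (simp add: p_def poly_sum poly_monom mult_ac del: fun_upd_apply) (simp add: mult_ac)
      qed
      then have "UNIV - {0} \<subseteq> {z. poly p z = 0}" by auto
      moreover have "infinite (UNIV - {0 :: complex})" by (simp add: infinite_UNIV_char_0)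
      ultimately have "p = 0" using poly_roots_finite finite_subset by blast
      then have "coeff p (e b0 v) = 0" by simp
      then show "(\<Sum>b\<in>?B. c b * (\<Prod>i\<in>V. x i ^ e b i)) = 0"
        using insert.prems(1) by (simp add: p_def coeff_sum sum.If_cases Int_def)
    qed
    then show "c b0 = 0" using b0 by simp
  qed
qed

context regular_coeff_ring
begin

text \<open>The product of the values of the letters of a word depends only on its exponents, so the
  sum in the hypothesis is the value of \<open>Phi f\<close> at \<open>x\<close>.\<close>

lemma Phi_eq_0I:
  assumes "finite V" and f: "f \<in> carrier R"
    and val: "\<And>x :: nat \<Rightarrow> complex. \<forall>i\<in>V. x i \<noteq> 0 \<Longrightarrow> (\<Sum>w\<in>supp f. ev1 (f w) * prod_list (map x w)) = 0"
  shows "Phi f = 0"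
proof -
  let ?e = "Poly_Mapping.lookup" and ?M = "wexp ` supp f"
  have fin: "finite (supp f)" and V: "\<And>w. w \<in> supp f \<Longrightarrow> set w \<subseteq> V"
    using f unfolding carrier_FA supp_def by blast+
  have "\<forall>m\<in>?M. ?e (Phi f) m = 0"
  proof (rule polynomial_identity[where e = ?e])
    fix m m' assume "m \<in> ?M" "m' \<in> ?M" and eq: "\<forall>i\<in>V. ?e m i = ?e m' i"
    \<comment> \<open>Outside \<open>V\<close> both exponents are 0, so agreement on
      \<open>V\<close> gives equality.\<close>
    then have sub: "Poly_Mapping.keys m \<subseteq> V" "Poly_Mapping.keys m' \<subseteq> V" by (auto simp: keys_wexp dest!: V)
    show "m = m'"
    proof (rule poly_mapping_eqI)
      show "?e m i = ?e m' i" for i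
        using eq sub by (metis in_keys_iff subsetD)
    qed
  next
    fix x :: "nat \<Rightarrow> complex" assume x: "\<forall>i\<in>V. x i \<noteq> 0"
    have prod: "prod_list (map x w) = (\<Prod>i\<in>V. x i ^ ?e (wexp w) i)" if "set w \<subseteq> V" for w
      using that
    proof (induction w)
      case (Cons k w)
      have "(\<Prod>i\<in>V. x i ^ ?e (wexp (k # w)) i) = (\<Prod>i\<in>V. (if i = k then x k else 1) * x i ^ ?e (wexp w) i)"
        by (rule prod.cong) (auto simp: lookup_add lookup_single)
      then show ?case using Cons assms(1) by (simp add: prod.distrib prod.delta)
    qed simp
    have "(\<Sum>m\<in>?M. ?e (Phi f) m * (\<Prod>i\<in>V. x i ^ ?e m i))
        = (\<Sum>m\<in>?M. \<Sum>w | w \<in> supp f \<and> wexp w = m. ev1 (f w) * prod_list (map x w))"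
      unfolding lookup_Phi[OF fin order_refl] sum_distrib_right
      using V by (intro sum.cong refl) (auto simp: prod)
    also have "\<dots> = (\<Sum>w\<in>supp f. ev1 (f w) * prod_list (map x w))"
      by (rule sum.group) (use fin in auto)
    also have "\<dots> = 0" by (rule val[OF x])
    finally show "(\<Sum>m\<in>?M. ?e (Phi f) m * (\<Prod>i\<in>V. x i ^ ?e m i)) = 0" .
  qed (use assms(1) fin in auto)
  moreover have "?e (Phi f) m = 0" if "m \<notin> ?M" for m
    unfolding lookup_Phi[OF fin order_refl] using that by (intro sum.neutral) auto
  ultimately show ?thesis by (intro poly_mapping_eqI) (metis lookup_zero)
qed

end

section \<open>Weight modules\<close>

lemma cst_mult: "cst (a * b) = cst a * cst b" by (simp add: cst_def mult.commute)
lemma cst_1 [simp]: "cst 1 = 1" by (simp add: cst_def One_fract_def one_pCons)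
lemma regular_at_1_cst [simp]: "regular_at_1 (cst z)" by (simp add: cst_def)

lemma cst_inverse: "z \<noteq> 0 \<Longrightarrow> cst (inverse z) * cst z = 1"
  by (simp add: cst_mult[symmetric])

lemma regular_at_1_sum:
  "(\<And>i. i \<in> A \<Longrightarrow> regular_at_1 (f i)) \<Longrightarrow>
    regular_at_1 (sum f A) \<and> ev1 (sum f A) = (\<Sum>i\<in>A. ev1 (f i))"
  by (induction A rule: infinite_finite_induct) (auto simp: regular_at_1_add ev1_add)

lemma sum_fun_apply: "(sum F A) (a :: 'x) = (\<Sum>i\<in>A. (F i a :: 'y :: comm_monoid_add))"
  by (induction A rule: infinite_finite_induct) auto

text \<open>The interface between the lifted group and the algebra: what follows refers to the
  scalars through these facts and through their derivatives at 1.\<close>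

locale weyl_data = regular_coeff_ring S "Vn n" for S n +
  fixes tq :: "nat \<Rightarrow> cf" and tlam :: "nat \<Rightarrow> nat \<Rightarrow> cf"
  assumes S_tau: "tau \<in> S"
    and S_divide: "\<And>f. f \<in> S \<Longrightarrow> ev1 f = 0 \<Longrightarrow> \<exists>c\<in>S. f = tau * c"
    and tq: "\<And>i. i \<in> {1..n} \<Longrightarrow> tq i \<in> S \<and> inverse (tq i) \<in> S \<and> tq i \<in> one_units"
    and tlam: "\<And>i j. i \<in> {1..n} \<Longrightarrow> j \<in> {1..n} \<Longrightarrow> tlam i j \<in> S \<and> tlam i j \<in> one_units"
    and tlam_inv: "\<And>i j. i \<in> {1..n} \<Longrightarrow> j \<in> {1..n} \<Longrightarrow> tlam i j = inverse (tlam j i)"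
begin

lemma tq_nz: "i \<in> {1..n} \<Longrightarrow> tq i \<noteq> 0"
  and tlam_nz: "i \<in> {1..n} \<Longrightarrow> j \<in> {1..n} \<Longrightarrow> tlam i j \<noteq> 0"
  using tq tlam one_units_nz by blast+

text \<open>How the weight of the normal element \<open>1 + y_1 x_1 + ... + y_i x_i\<close> varies
  with \<open>a\<close>: by the relations it passes \<open>y_k\<close> at the cost of a factor
  \<open>tq k\<close> when \<open>k \<le> i\<close>, and commutes with the later
  \<open>y_k\<close>.\<close>

definition P :: "nat \<Rightarrow> (nat \<Rightarrow> int) \<Rightarrow> cf" where
  "P i a = (\<Prod>k\<in>{1..i}. tq k powi a k)"

definition Lam :: "nat \<Rightarrow> (nat \<Rightarrow> int) \<Rightarrow> cf" where
  "Lam j a = (\<Prod>k\<in>{1..<j}. tlam j k powi a k)"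

lemma P_units: "i \<le> n \<Longrightarrow> P i a \<in> one_units"
  and Lam_units: "j \<in> {1..n} \<Longrightarrow> Lam j a \<in> one_units"
  unfolding P_def Lam_def
  using one_units_prod[of "{1..i}" "\<lambda>k. tq k powi a k"] one_units_prod[of "{1..<j}" "\<lambda>k. tlam j k powi a k"]
    tq tlam one_units_powi by auto

lemma prod_shift:
  fixes f :: "nat \<Rightarrow> 'a :: field"
  assumes "finite A" "j \<in> A \<Longrightarrow> f j \<noteq> 0"
  shows "(\<Prod>k\<in>A. f k powi (a(j := a j + d)) k) = (if j \<in> A then f j powi d else 1) * (\<Prod>k\<in>A. f k powi a k)"
proof -
  have "(\<Prod>k\<in>A. f k powi (a(j := a j + d)) k) = (\<Prod>k\<in>A. (if k = j then f j powi d else 1) * f k powi a k)"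
    using assms(2) by (intro prod.cong) (auto simp: power_int_add)
  then show ?thesis using assms(1) by (simp add: prod.distrib prod.delta)
qed

lemma P_shift:
  assumes "i \<le> n"
  shows "P i (a(j := a j + d)) = (if j \<in> {1..i} then tq j powi d else 1) * P i a"
  unfolding P_def by (rule prod_shift) (use assms tq_nz in auto)

lemma Lam_shift:
  assumes "i \<in> {1..n}"
  shows "Lam i (a(j := a j + d)) = (if j \<in> {1..<i} then tlam i j powi d else 1) * Lam i a"
  unfolding Lam_def by (rule prod_shift) (use assms tlam_nz in auto)

end

text \<open>A weight module on which the elements \<open>1 + (\<Sum>k\<le>i. y_k x_k)\<close>, normal in the algebra,
  act diagonally with weights \<open>Z i\<close>.  At \<open>t = 1\<close> the letters \<open>y_j\<close>, \<open>x_j\<close> multiply constant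
  functions by the complex numbers \<open>pt (2 * j)\<close>, \<open>pt (2 * j + 1)\<close>.\<close>

locale weight_module = weyl_data +
  fixes pt :: "nat \<Rightarrow> complex"
  assumes pt_nz: "\<And>j. j \<in> {1..n} \<Longrightarrow> pt (2 * j) \<noteq> 0"
begin

text \<open>The weights at \<open>a = 0\<close> are free parameters of the module. This choice makes
  consecutive ones differ by the product of the two coordinates with the same index, as the point
  \<open>pt\<close> demands.\<close>

definition zeta :: "nat \<Rightarrow> complex" where
  "zeta i = 1 + (\<Sum>k\<in>{1..i}. pt (2 * k) * pt (2 * k + 1))"

definition Z :: "nat \<Rightarrow> (nat \<Rightarrow> int) \<Rightarrow> cf" where
  "Z i a = cst (zeta i) * P i a"

text \<open>With \<open>v_a = y\<^sub>1^a\<^sub>1 \<cdots> y\<^sub>n^a\<^sub>n v\<^sub>0\<close>, the relations force the factor \<open>Lam j a\<close> when \<open>y_j\<close> is moved into place,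
  and \<open>y_j x_j\<close> is the difference of two consecutive normal elements, hence
  \<open>x_j = y_j\<^sup>-\<^sup>1 (Z j - Z (j - 1))\<close>. The operators below are these, written on coefficient functions.\<close>

definition opY :: "nat \<Rightarrow> ((nat \<Rightarrow> int) \<Rightarrow> cf) \<Rightarrow> (nat \<Rightarrow> int) \<Rightarrow> cf" where
  "opY j g = (\<lambda>a. cst (pt (2 * j)) * Lam j a * g (a(j := a j + -1)))"

definition opX :: "nat \<Rightarrow> ((nat \<Rightarrow> int) \<Rightarrow> cf) \<Rightarrow> (nat \<Rightarrow> int) \<Rightarrow> cf" where
  "opX j g = (\<lambda>a. cst (inverse (pt (2 * j))) * inverse (Lam j a) * (tq j * Z j a - Z (j - 1) a)
     * g (a(j := a j + 1)))"

definition letter :: "nat \<Rightarrow> ((nat \<Rightarrow> int) \<Rightarrow> cf) \<Rightarrow> (nat \<Rightarrow> int) \<Rightarrow> cf" where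
  "letter k = (if even k then opY (k div 2) else opX (k div 2))"

lemma letter_even [simp]: "letter (2 * j) = opY j" and letter_odd [simp]: "letter (Suc (2 * j)) = opX j"
  by (simp_all add: letter_def)

sublocale rep: free_action S "Vn n" "\<lambda>c g a. c * g a" letter
  by unfold_locales (auto simp: letter_def opY_def opX_def fun_eq_iff algebra_simps)

lemma Z_shift:
  assumes "i \<le> n"
  shows "Z i (a(j := a j + d)) = (if j \<in> {1..i} then tq j powi d else 1) * Z i a"
  unfolding Z_def using P_shift[OF assms] by (simp add: mult_ac)

lemma Z_0 [simp]: "Z 0 a = 1"
  by (simp add: Z_def P_def zeta_def)

context
  fixes i j assumes ij: "1 \<le> i" "i < j" "j \<le> n"
begin

lemma index_bounds: "i \<in> {1..n}" "j \<in> {1..n}" "i \<noteq> j" "i \<in> {1..<j}" "j \<notin> {1..<i}" 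
    "i \<in> {1..j}" "i \<in> {1..j - 1}" "j \<notin> {1..i}" "j \<notin> {1..i - 1}" "i \<le> n" "i - 1 \<le> n" "j \<le> n" "j - 1 \<le> n"
  using ij by auto

lemma scalars_nz: "tq i \<noteq> 0" "tlam j i \<noteq> 0" "Lam i a \<noteq> 0" "Lam j a \<noteq> 0"
  using index_bounds tq_nz tlam_nz one_units_nz[OF Lam_units] by auto

lemma tlam_ij: "tlam i j = inverse (tlam j i)"
  by (rule tlam_inv[OF index_bounds(1,2)])

lemma twist: "a(i := a i + c, j := (a(i := a i + c)) j + d) = a(j := a j + d, i := (a(j := a j + d)) i + c)"
  using index_bounds(3) by (simp add: fun_upd_twist)

lemmas shifts = Lam_shift[OF index_bounds(1)] Lam_shift[OF index_bounds(2)] Z_shift[OF index_bounds(10)] Z_shift[OF index_bounds(11)]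
  Z_shift[OF index_bounds(12)] Z_shift[OF index_bounds(13)] if_P[OF index_bounds(4)] if_P[OF index_bounds(6)] if_P[OF index_bounds(7)]
  if_not_P[OF index_bounds(5)] if_not_P[OF index_bounds(8)] if_not_P[OF index_bounds(9)]

text \<open>For \<open>i < j\<close> only \<open>Lam j\<close>, \<open>Z j\<close> and
  \<open>Z (j - 1)\<close> feel a shift in direction \<open>i\<close>, and \<open>Lam i\<close>,
  \<open>Z i\<close>, \<open>Z (i - 1)\<close> feel none in direction \<open>j\<close>. So
  \<open>Lam j\<close> supplies the power of \<open>tlam j i\<close>, while \<open>Z j\<close> and
  \<open>Z (j - 1)\<close> scale by the same power of \<open>tq i\<close>. This settles all four
  off-diagonal relations.\<close>

lemma YY: "opY j (opY i g) = (\<lambda>a. tlam j i * opY i (opY j g) a)"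
  unfolding opY_def by (rule ext) (simp only: shifts twist, simp add: scalars_nz power_int_minus mult_ac)

lemma YX: "opY j (opX i g) = (\<lambda>a. tlam i j * opX i (opY j g) a)"
  unfolding opY_def opX_def tlam_ij by (rule ext) (simp only: shifts twist, simp add: scalars_nz power_int_minus mult_ac)

lemma XY: "opX j (opY i g) = (\<lambda>a. tq i * tlam i j * opY i (opX j g) a)"
  unfolding opY_def opX_def tlam_ij
  by (rule ext) (simp only: shifts twist, simp add: scalars_nz power_int_minus field_simps)

lemma XX: "opX j (opX i g) = (\<lambda>a. inverse (tq i) * inverse (tlam i j) * opX i (opX j g) a)"
  unfolding opX_def tlam_ij
  by (rule ext) (simp only: shifts twist, simp add: scalars_nz power_int_minus field_simps)

end

text \<open>\<open>opX i\<close> reads its argument at the weight with \<open>a i\<close> raised by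
  1, where the normal elements have weights \<open>tq i * Z i a\<close> and
  \<open>Z (i - 1) a\<close>; hence the factor \<open>tq i\<close> in its definition. Applying
  \<open>opY i\<close> afterwards shifts back and absorbs the factor, applying it before does
  not.\<close>

lemma YX_diag:
  assumes "i \<in> {1..n}"
  shows "opY i (opX i g) = (\<lambda>a. (Z i a - Z (i - 1) a) * g a)"
    and "opX i (opY i g) = (\<lambda>a. (tq i * Z i a - Z (i - 1) a) * g a)"
proof -
  have mem: "i \<le> n" "i - 1 \<le> n" "i \<in> {1..i}" "i \<notin> {1..i - 1}" "i \<notin> {1..<i}" using assms by auto
  have nz: "Lam i a \<noteq> 0" "tq i \<noteq> 0" for a using assms tq_nz one_units_nz[OF Lam_units] by auto
  note shifts = Lam_shift[OF assms] Z_shift[OF mem(1)] Z_shift[OF mem(2)] if_P[OF mem(3)]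
    if_not_P[OF mem(4)] if_not_P[OF mem(5)]
  have c: "cst (pt (2 * i)) * (cst (inverse (pt (2 * i))) * u) = u"
     "cst (inverse (pt (2 * i))) * (cst (pt (2 * i)) * u) = u" for u
  proof -
    have "cst (inverse (pt (2 * i))) * cst (pt (2 * i)) = 1" by (rule cst_inverse[OF pt_nz[OF assms]])
    then show "cst (pt (2 * i)) * (cst (inverse (pt (2 * i))) * u) = u"
      "cst (inverse (pt (2 * i))) * (cst (pt (2 * i)) * u) = u"
      by (metis mult.assoc mult.commute mult_1)+
  qed
  show "opY i (opX i g) = (\<lambda>a. (Z i a - Z (i - 1) a) * g a)"
    unfolding opY_def opX_def
    by (rule ext, simp only: shifts) (simp add: nz power_int_minus c mult.assoc mult.left_commute[of "Lam _ _"], simp add: nz field_simps)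
  show "opX i (opY i g) = (\<lambda>a. (tq i * Z i a - Z (i - 1) a) * g a)"
    unfolding opY_def opX_def
    by (rule ext, simp only: shifts) (simp add: nz power_int_minus c mult.assoc mult.left_commute[of "inverse (Lam _ _)"])
qed

text \<open>The differences telescope, starting from \<open>Z 0 = 1\<close>.\<close>

lemma YX_sum:
  assumes "i \<le> n"
  shows "g a + (\<Sum>k\<in>{1..i}. opY k (opX k g) a) = Z i a * g a"
  using assms
proof (induction i)
  case (Suc i)
  then show ?case using YX_diag(1)[of "Suc i" g] by (simp add: algebra_simps)
qed simp

text \<open>The shift of the argument does not matter, because \<open>g\<close> has the same value
  \<open>c\<close> at \<open>t = 1\<close> for every weight; the factors \<open>Lam j\<close> and
  \<open>tq j\<close> become 1.\<close>

lemma letter_regular: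
  assumes "k \<in> Vn n" and g: "\<And>a. regular_at_1 (g a) \<and> ev1 (g a) = c"
  shows "regular_at_1 (letter k g a) \<and> ev1 (letter k g a) = pt k * c"
proof -
  obtain j where j: "j \<in> {1..n}" and k: "k = 2 * j \<or> k = Suc (2 * j)"
    using assms(1) by (auto simp: Vn_def)
  have L: "regular_at_1 (Lam j a)" "ev1 (Lam j a) = 1" using Lam_units[OF j] by (auto simp: one_units_def)
  have Z: "regular_at_1 (Z i a) \<and> ev1 (Z i a) = zeta i" if "i \<le> n" for i
    using P_units[OF that] by (auto simp: Z_def one_units_def regular_at_1_mult ev1_mult)
  have q: "regular_at_1 (tq j)" "ev1 (tq j) = 1" using tq[OF j] by (auto simp: one_units_def)
  \<comment> \<open>This factor of \<open>opX\<close> becomes \<open>zeta j - zeta (j - 1)\<close>;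
    dividing it by the coordinate of \<open>y_j\<close> leaves that of \<open>x_j\<close>.\<close>
  have D: "regular_at_1 (tq j * Z j a - Z (j - 1) a) \<and>
    ev1 (tq j * Z j a - Z (j - 1) a) = pt (2 * j) * pt (2 * j + 1)"
  proof -
    have Zj: "regular_at_1 (Z j a)" "ev1 (Z j a) = zeta j"
      "regular_at_1 (Z (j - 1) a)" "ev1 (Z (j - 1) a) = zeta (j - 1)"
      using Z[of j] Z[of "j - 1"] j by auto
    have "zeta j = zeta (j - 1) + pt (2 * j) * pt (2 * j + 1)"
      using j by (cases j) (simp_all add: zeta_def)
    then show ?thesis
      by (simp only: regular_at_1_diff regular_at_1_mult ev1_diff ev1_mult q Zj) simp
  qed
  show ?thesis
    using k
  proof
    assume k: "k = 2 * j"
    show ?thesis using L g unfolding k letter_even opY_def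
      by (simp add: regular_at_1_mult ev1_mult)
  next
    assume k: "k = Suc (2 * j)"
    show ?thesis using L g D pt_nz[OF j] unfolding k letter_odd opX_def
      by (simp add: regular_at_1_mult ev1_mult regular_at_1_inverse ev1_inverse)
  qed
qed

lemma word_regular:
  assumes "set w \<subseteq> Vn n"
  shows "regular_at_1 (foldr letter w (\<lambda>_. 1) a) \<and> ev1 (foldr letter w (\<lambda>_. 1) a) = prod_list (map pt w)"
  using assms
proof (induction w arbitrary: a)
  case (Cons k w)
  then show ?case using letter_regular[of k "foldr letter w (\<lambda>_. 1)" "prod_list (map pt w)" a] by simp
qed simp

lemma ev1_act:
  assumes "f \<in> carrier R"
  shows "ev1 (rep.act f (\<lambda>_. 1) a) = (\<Sum>w\<in>supp f. ev1 (f w) * prod_list (map pt w))"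
proof -
  have "regular_at_1 (f w) \<and> set w \<subseteq> Vn n" if "w \<in> supp f" for w
    using assms that S_regular unfolding carrier_FA supp_def by blast
  then show ?thesis
    using regular_at_1_sum[of "supp f" "\<lambda>w. f w * foldr letter w (\<lambda>_. 1) a"] word_regular
    by (simp add: rep.act_def sum_fun_apply regular_at_1_mult ev1_mult)
qed

end

section \<open>The relations and torsion\<close>

lemma setcompr2_cong:
  "(\<And>i j. C i j \<Longrightarrow> f i j = g i j) \<Longrightarrow> {f i j | i j. C i j} = {g i j | i j. C i j}"
  by (auto, metis)

text \<open>\<open>tm1A\<close> is given as a set of multiples and not as a generated ideal, so its
  being an ideal comes from the centrality of \<open>tau\<close>.\<close>

lemma central_multiples_ideal:
  fixes R (structure)
  assumes "ring R" and t: "t \<in> carrier R" and central: "\<And>a. a \<in> carrier R \<Longrightarrow> a \<otimes> t = t \<otimes> a"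
  shows "ideal {t \<otimes> a | a. a \<in> carrier R} R"
proof -
  interpret ring R by fact
  let ?J = "{t \<otimes> a | a. a \<in> carrier R}"
  have J: "t \<otimes> a \<in> ?J" if "a \<in> carrier R" for a using that by blast
  show ?thesis
  proof (rule idealI[OF assms(1)])
    show "subgroup ?J (add_monoid R)"
    proof (rule add.subgroupI)
      show "?J \<noteq> {}" using J by blast
      show "\<ominus> a \<in> ?J" if "a \<in> ?J" for a
        using that t J[OF a_inv_closed] by (auto simp: r_minus[symmetric])
      show "a \<oplus> b \<in> ?J" if "a \<in> ?J" "b \<in> ?J" for a b
        using that t J[OF a_closed] by (auto simp: r_distr[symmetric])
    qed (use t in auto)
  next
    fix a x assume "a \<in> ?J" and x: "x \<in> carrier R"
    then obtain b where b: "b \<in> carrier R" "a = t \<otimes> b" by blast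
    have "x \<otimes> a = t \<otimes> (x \<otimes> b)" "a \<otimes> x = t \<otimes> (b \<otimes> x)"
      using b x t central[OF x] by (simp_all add: m_assoc[symmetric])
    then show "x \<otimes> a \<in> ?J" "a \<otimes> x \<in> ?J" using b x J by auto
  qed
qed

text \<open>Two surjections from one ring with the same fibres have isomorphic targets: the value at
  \<open>b\<close> is \<open>f\<close> of any preimage of \<open>b\<close> under
  \<open>h\<close>.\<close>

lemma ring_iso_of_same_kernel:
  fixes h :: "'a \<Rightarrow> 'b" and f :: "'a \<Rightarrow> 'c"
  assumes h: "h \<in> ring_hom R B" "\<And>b. b \<in> carrier B \<Longrightarrow> \<exists>x\<in>carrier R. h x = b"
    and f: "f \<in> ring_hom R C" "\<And>c. c \<in> carrier C \<Longrightarrow> \<exists>x\<in>carrier R. f x = c"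
    and eq: "\<And>x y. x \<in> carrier R \<Longrightarrow> y \<in> carrier R \<Longrightarrow> h x = h y \<longleftrightarrow> f x = f y"
    and R: "ring R"
  shows "\<exists>\<phi>\<in>ring_iso B C. \<forall>x\<in>carrier R. \<phi> (h x) = f x"
proof -
  interpret ring R by (rule R)
  define \<phi> where "\<phi> b = f (SOME x. x \<in> carrier R \<and> h x = b)" for b
  have \<phi>: "\<phi> (h x) = f x" if x: "x \<in> carrier R" for x
    unfolding \<phi>_def using someI[of "\<lambda>y. y \<in> carrier R \<and> h y = h x" x] eq x by blast
  have "\<phi> \<in> ring_iso B C"
  proof (rule ring_iso_memI)
    show "\<phi> b \<in> carrier C" if "b \<in> carrier B" for b
      using h(2)[OF that] \<phi> f(1) by (auto simp: ring_hom_closed)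
    show "\<phi> (a \<otimes>\<^bsub>B\<^esub> b) = \<phi> a \<otimes>\<^bsub>C\<^esub> \<phi> b" "\<phi> (a \<oplus>\<^bsub>B\<^esub> b) = \<phi> a \<oplus>\<^bsub>C\<^esub> \<phi> b"
      if ab: "a \<in> carrier B" "b \<in> carrier B" for a b
    proof -
      obtain x y where xy: "x \<in> carrier R" "h x = a" "y \<in> carrier R" "h y = b" using h(2) ab by meson
      then show "\<phi> (a \<otimes>\<^bsub>B\<^esub> b) = \<phi> a \<otimes>\<^bsub>C\<^esub> \<phi> b"
        using \<phi>[of "x \<otimes>\<^bsub>R\<^esub> y"] \<phi>[of x] \<phi>[of y] h(1) f(1) by (simp add: ring_hom_mult)
      show "\<phi> (a \<oplus>\<^bsub>B\<^esub> b) = \<phi> a \<oplus>\<^bsub>C\<^esub> \<phi> b"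
        using xy \<phi>[of "x \<oplus>\<^bsub>R\<^esub> y"] \<phi>[of x] \<phi>[of y] h(1) f(1) by (simp add: ring_hom_add)
    qed
    show "\<phi> \<one>\<^bsub>B\<^esub> = \<one>\<^bsub>C\<^esub>" using \<phi>[OF one_closed] h(1) f(1) by (simp add: ring_hom_one)
    show "bij_betw \<phi> (carrier B) (carrier C)"
    proof (rule bij_betw_imageI)
      show "inj_on \<phi> (carrier B)"
      proof (rule inj_onI)
        fix a b assume ab: "a \<in> carrier B" "b \<in> carrier B" "\<phi> a = \<phi> b"
        obtain x where x: "x \<in> carrier R" "h x = a" using h(2)[OF ab(1)] by blast
        obtain y where y: "y \<in> carrier R" "h y = b" using h(2)[OF ab(2)] by blast
        have "f x = f y" using ab(3) \<phi>[OF x(1)] \<phi>[OF y(1)] x(2) y(2) by simp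
        then show "a = b" using eq[OF x(1) y(1)] x(2) y(2) by simp
      qed
      show "\<phi> ` carrier B = carrier C"
      proof (intro subset_antisym subsetI)
        fix c assume "c \<in> \<phi> ` carrier B"
        then obtain b where b: "b \<in> carrier B" "c = \<phi> b" by blast
        obtain x where "x \<in> carrier R" "h x = b" using h(2)[OF b(1)] by blast
        then show "c \<in> carrier C" using \<phi>[of x] b(2) ring_hom_closed[OF f(1), of x] by simp
      next
        fix c assume "c \<in> carrier C"
        then obtain x where x: "x \<in> carrier R" "f x = c" using f(2) by blast
        then have "c = \<phi> (h x)" "h x \<in> carrier B" using \<phi>[of x] ring_hom_closed[OF h(1), of x] by auto
        then show "c \<in> \<phi> ` carrier B" by blast
      qed
    qed
  qed
  then show ?thesis using \<phi> by blast
qed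

context weyl_data
begin

lemma gen_closed: "k \<in> Vn n \<Longrightarrow> gen k \<in> carrier R"
  unfolding gen_mono by (rule mono_closed) (auto simp: S_1)

lemma letter_closed [simp]:
  assumes "i \<in> {1..n}"
  shows "Yg i \<in> carrier R" "Xg i \<in> carrier R"
proof -
  have "2 * i \<in> Vn n" "2 * i + 1 \<in> Vn n" using assms unfolding Vn_def by blast+
  then show "Yg i \<in> carrier R" "Xg i \<in> carrier R" unfolding Yg_def Xg_def by (simp_all only: gen_closed)
qed

lemma sc_closed [simp]: "c \<in> S \<Longrightarrow> sc c \<in> carrier R"
  unfolding sc_mono by (rule mono_closed) auto

lemma conv_sc: "conv (sc c) f = (\<lambda>w. c * f w)"
  by (simp add: sc_mono conv_scalar_left)

lemma conv_sc_conv: "conv (conv (sc c) f) g = (\<lambda>w. c * conv f g w)"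
  by (subst conv_assoc) (simp only: conv_sc)

lemma conv_scale_left: "conv (\<lambda>w. c * f w) g = (\<lambda>w. c * conv f g w)"
  using conv_sc_conv[of c f g] by (simp only: conv_sc)

text \<open>The common shape of the four off-diagonal families, so that \<open>Phi\<close>, the
  modules and the bracket each treat them once.\<close>

definition relator :: "cf \<Rightarrow> fa \<Rightarrow> fa \<Rightarrow> fa" where
  "relator c f g = conv f g - conv (conv (sc c) g) f"

definition relator_diag :: "nat \<Rightarrow> fa" where
  "relator_diag i = relator (tq i) (Xg i) (Yg i)
     - conv (sc (tq i - 1)) (wmono 1 [] + (\<Sum>k\<in>{1..<i}. conv (Yg k) (Xg k)))"

lemma relator_closed [simp]:
  "c \<in> S \<Longrightarrow> f \<in> carrier R \<Longrightarrow> g \<in> carrier R \<Longrightarrow> relator c f g \<in> carrier R"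
  unfolding relator_def by (intro minus_closed conv_closed sc_closed)

lemma S_diff: "a \<in> S \<Longrightarrow> b \<in> S \<Longrightarrow> a - b \<in> S"
  using S_add[of a "- b"] S_minus by simp

lemma normal_sum_closed: "i \<le> n \<Longrightarrow> wmono 1 [] + (\<Sum>k\<in>{1..i}. conv (Yg k) (Xg k)) \<in> carrier R"
  by (intro add_closed sum_closed conv_closed mono_closed) (auto simp: S_1)

lemma normal_sum_closed': "i \<in> {1..n} \<Longrightarrow> wmono 1 [] + (\<Sum>k\<in>{1..<i}. conv (Yg k) (Xg k)) \<in> carrier R"
  by (intro add_closed sum_closed conv_closed mono_closed) (auto simp: S_1)

lemma relator_diag_closed [simp]: "i \<in> {1..n} \<Longrightarrow> relator_diag i \<in> carrier R"
  unfolding relator_diag_def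
  by (intro minus_closed conv_closed sc_closed relator_closed normal_sum_closed') (auto simp: tq S_diff S_1)

lemma scalars_S [simp]:
  assumes "i \<in> {1..n}" "j \<in> {1..n}"
  shows "tlam i j \<in> S" "tq i * tlam i j \<in> S" "inverse (tq i) * inverse (tlam i j) \<in> S"
    "tlam i j \<in> one_units" "tq i * tlam i j \<in> one_units" "inverse (tq i) * inverse (tlam i j) \<in> one_units"
  using tq[OF assms(1)] tlam[OF assms] tlam[OF assms(2,1)] tlam_inv[OF assms(2,1)]
  by (auto simp: S_mult one_units_mult one_units_inverse)

text \<open>Subtraction and finite sums of the ring record are tied to the pointwise ones only on
  the carrier; after this translation the computations are pointwise.\<close>

lemma rels_eq: "rels n S tq tlam =
     {relator (tlam j i) (Yg j) (Yg i) | i j. 1 \<le> i \<and> i < j \<and> j \<le> n}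
   \<union> {relator (tlam i j) (Yg j) (Xg i) | i j. 1 \<le> i \<and> i < j \<and> j \<le> n}
   \<union> {relator (tq i * tlam i j) (Xg j) (Yg i) | i j. 1 \<le> i \<and> i < j \<and> j \<le> n}
   \<union> {relator (inverse (tq i) * inverse (tlam i j)) (Xg j) (Xg i) | i j. 1 \<le> i \<and> i < j \<and> j \<le> n}
   \<union> {relator_diag i | i. 1 \<le> i \<and> i \<le> n}"
proof -
  have 1: "conv f g \<ominus>\<^bsub>R\<^esub> conv (conv (sc c) g) f = relator c f g"
    if "f \<in> carrier R" "g \<in> carrier R" "c \<in> S" for c f g
    unfolding relator_def by (rule minus_FA) (use that in \<open>auto intro!: conv_closed\<close>)
  have 2: "conv (Xg i) (Yg i) \<ominus>\<^bsub>R\<^esub> conv (conv (sc (tq i)) (Yg i)) (Xg i) \<ominus>\<^bsub>R\<^esub>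
      conv (sc (tq i - 1)) (wmono 1 [] + (\<Oplus>\<^bsub>R\<^esub>k\<in>{1..<i}. conv (Yg k) (Xg k))) = relator_diag i"
    if i: "i \<in> {1..n}" for i
  proof -
    have "(\<Oplus>\<^bsub>R\<^esub>k\<in>{1..<i}. conv (Yg k) (Xg k)) = (\<Sum>k\<in>{1..<i}. conv (Yg k) (Xg k))"
      by (rule finsum_FA) (use i in \<open>auto intro!: conv_closed\<close>)
    then show ?thesis unfolding relator_diag_def using i tq[OF i]
      by (simp only: 1 letter_closed)
        (rule minus_FA[OF relator_closed conv_closed[OF sc_closed normal_sum_closed'[OF i]]],
          simp_all add: S_diff S_1)
  qed
  have 3: "{f i | i. C i} = {g i | i. C i}" if "\<And>i. C i \<Longrightarrow> f i = g i" for f g :: "nat \<Rightarrow> fa" and C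
    using that by (auto, metis)
  show ?thesis
    unfolding rels_def Let_def mult_FA add_FA one_FA
    by (intro arg_cong2[where f = "(\<union>)"] setcompr2_cong 3)
      ((auto intro!: 1)[4], rule 2, simp)
qed

lemma rels_cases:
  assumes "x \<in> rels n S tq tlam"
  obtains (YY) i j where "1 \<le> i" "i < j" "j \<le> n" "x = relator (tlam j i) (Yg j) (Yg i)"
  | (YX) i j where "1 \<le> i" "i < j" "j \<le> n" "x = relator (tlam i j) (Yg j) (Xg i)"
  | (XY) i j where "1 \<le> i" "i < j" "j \<le> n" "x = relator (tq i * tlam i j) (Xg j) (Yg i)"
  | (XX) i j where "1 \<le> i" "i < j" "j \<le> n" "x = relator (inverse (tq i) * inverse (tlam i j)) (Xg j) (Xg i)"
  | (diag) i where "1 \<le> i" "i \<le> n" "x = relator_diag i"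
  using assms unfolding rels_eq by blast

lemma rels_closed: "rels n S tq tlam \<subseteq> carrier R"
proof
  fix x assume "x \<in> rels n S tq tlam"
  then show "x \<in> carrier R" by (cases rule: rels_cases) auto
qed

abbreviation "I \<equiv> genideal R (rels n S tq tlam)"

lemma ideal_I: "ideal I R" by (rule FA.genideal_ideal[OF rels_closed])

lemma rels_I: "x \<in> rels n S tq tlam \<Longrightarrow> x \<in> I"
  using FA.genideal_self[OF rels_closed] by blast

lemma Phi_letters [simp]: "Phi (Yg i) = pvar (2 * i)" "Phi (Xg i) = pvar (2 * i + 1)"
  by (simp_all add: Yg_def Xg_def Phi_gen)

lemma ev1_one_units: "c \<in> one_units \<Longrightarrow> ev1 c = 1" by (simp add: one_units_def)

lemma Phi_relator:
  assumes "c \<in> S" "c \<in> one_units" "f \<in> carrier R" "g \<in> carrier R"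
  shows "Phi (relator c f g) = 0"
  using assms unfolding relator_def
  by (simp add: Phi_diff Phi_conv Phi_sc conv_closed pconst_1 ev1_one_units mult.commute)

lemma Phi_rels:
  assumes "x \<in> rels n S tq tlam"
  shows "Phi x = 0"
  using assms
proof (cases rule: rels_cases)
  case (diag i)
  then have i: "i \<in> {1..n}" by simp
  have "ev1 (tq i - 1) = 0"
    using tq[OF i] by (simp add: ev1_diff one_units_def)
  then show ?thesis unfolding diag(3) relator_diag_def using tq[OF i] i normal_sum_closed'[OF i]
    by (simp add: Phi_diff Phi_relator Phi_conv Phi_sc conv_closed S_diff S_1) (simp add: pconst_def)
qed (simp_all add: Phi_relator)

lemma Phi_I: "f \<in> I \<Longrightarrow> Phi f = 0"
  unfolding Phi_def by (rule spec.genideal_annihilated[OF rels_closed]) (simp_all add: act_spec Phi_rels)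

end

context weight_module
begin

lemma act_letters [simp]: "rep.act (Yg i) g = opY i g" "rep.act (Xg i) g = opX i g"
  using S_1 by (simp_all add: Yg_def Xg_def gen_mono rep.act_wmono)

lemma act_scalar: "c \<in> S \<Longrightarrow> rep.act (sc c) g = (\<lambda>a. c * g a)"
  by (simp add: sc_mono rep.act_wmono)

lemma act_relator:
  assumes "c \<in> S" "f \<in> carrier R" "h \<in> carrier R"
    and "rep.act f (rep.act h g) = (\<lambda>a. c * rep.act h (rep.act f g) a)"
  shows "rep.act (relator c f h) g = 0"
  using assms unfolding relator_def
  by (simp add: rep.act_diff rep.act_conv act_scalar conv_closed)

lemma act_rels:
  assumes "x \<in> rels n S tq tlam"
  shows "rep.act x g = 0"
  using assms
proof (cases rule: rels_cases)
  case (diag i)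
  then have i: "i \<in> {1..n}" by simp
  have "(\<Sum>k\<in>{1..<i}. opY k (opX k g)) a = (\<Sum>k\<in>{1..i - 1}. opY k (opX k g) a)" for a
    unfolding sum_fun_apply using i by (intro sum.cong) auto
  then have s: "g a + (\<Sum>k\<in>{1..<i}. opY k (opX k g)) a = Z (i - 1) a * g a" for a
    using YX_sum[of "i - 1" g a] i by (simp add: le_diff_conv)
  have "rep.act (wmono 1 [] + (\<Sum>k\<in>{1..<i}. conv (Yg k) (Xg k))) g
      = g + (\<Sum>k\<in>{1..<i}. opY k (opX k g))"
  proof -
    have YX: "conv (Yg k) (Xg k) \<in> carrier R" "rep.act (conv (Yg k) (Xg k)) g = opY k (opX k g)"
      if "k \<in> {1..<i}" for k
      using that i by (simp_all add: conv_closed rep.act_conv)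
    have "rep.act (\<Sum>k\<in>{1..<i}. conv (Yg k) (Xg k)) g = (\<Sum>k\<in>{1..<i}. opY k (opX k g))"
      by (subst rep.act_sum) (use YX in auto)
    moreover have "(\<Sum>k\<in>{1..<i}. conv (Yg k) (Xg k)) \<in> carrier R"
      by (rule sum_closed) (rule YX)
    ultimately show ?thesis
      using S_1 by (subst rep.act_add) (auto simp: rep.act_wmono)
  qed
  then have N: "rep.act (wmono 1 [] + (\<Sum>k\<in>{1..<i}. conv (Yg k) (Xg k))) g = (\<lambda>a. Z (i - 1) a * g a)"
    using s by (simp add: fun_eq_iff)
  \<comment> \<open>The diagonal relation reduces to the scalar identity
    \<open>(q Z - Z') - q (Z - Z') - (q - 1) Z' = 0\<close>, with \<open>Z'\<close> the preceding
    weight.\<close>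
  have "rep.act x g = (\<lambda>a. (tq i * Z i a - Z (i - 1) a) * g a) - (\<lambda>a. tq i * ((Z i a - Z (i - 1) a) * g a))
      - (\<lambda>a. (tq i - 1) * (Z (i - 1) a * g a))"
    unfolding diag(3) relator_diag_def relator_def
    using i tq[OF i] normal_sum_closed'[OF i]
    by (simp only: rep.act_diff rep.act_conv act_scalar conv_closed minus_closed S_diff S_1 N
        act_letters YX_diag letter_closed sc_closed)
  then show ?thesis by (simp add: fun_eq_iff algebra_simps)
qed (simp_all add: act_relator YY YX XY XX)

end

context weyl_data
begin

text \<open>Elements of \<open>I\<close> act as 0, and \<open>tau\<close> cancels in the field of
  values, so \<open>f\<close> kills the constant function 1. Reading the result at weight 0 and at
  \<open>t = 1\<close> gives the value of \<open>Phi f\<close> at \<open>x\<close>.\<close>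

lemma tau_torsion:
  assumes f: "f \<in> carrier R" and I: "conv (sc tau) f \<in> I"
  shows "Phi f = 0"
proof (rule Phi_eq_0I[OF _ f])
  show "finite (Vn n)" by (simp add: Vn_def)
  fix x :: "nat \<Rightarrow> complex" assume x: "\<forall>i\<in>Vn n. x i \<noteq> 0"
  interpret weight_module S n tq tlam x
    by unfold_locales (use x in \<open>auto simp: Vn_def\<close>)
  have "rep.act (conv (sc tau) f) (\<lambda>_. 1) = 0"
    by (rule rep.genideal_annihilated[OF rels_closed _ I]) (rule act_rels)
  then have "tau * rep.act f (\<lambda>_. 1) (\<lambda>_. 0) = 0"
    using f by (auto simp: rep.act_conv act_scalar S_tau fun_eq_iff)
  then have "rep.act f (\<lambda>_. 1) (\<lambda>_. 0) = 0" using tau_nz by simp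
  then show "(\<Sum>w\<in>supp f. ev1 (f w) * prod_list (map x w)) = 0"
    using ev1_act[OF f, of "\<lambda>_. 0"] by simp
qed

end

section \<open>The algebra, its fibre at \<open>t = 1\<close> and the bracket\<close>

context weyl_data
begin

abbreviation "AA \<equiv> Aalg n S tq tlam"
abbreviation "AA1 \<equiv> A1alg n S tq tlam"
abbreviation "cl \<equiv> clsA n S tq tlam"
abbreviation "cl1 \<equiv> cls1 n S tq tlam"

lemma cl_eq: "cl = (+>\<^bsub>R\<^esub>) I" by (rule ext) (simp add: clsA_def)

lemma ring_A: "ring AA" unfolding Aalg_def by (rule ideal.quotient_is_ring[OF ideal_I])

sublocale A: ring AA by (rule ring_A)

lemma cl_hom: "cl \<in> ring_hom R AA"
  unfolding cl_eq Aalg_def by (rule ideal.rcos_ring_hom[OF ideal_I])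

lemma cl_closed [simp]: "f \<in> carrier R \<Longrightarrow> cl f \<in> carrier AA"
  by (rule ring_hom_closed[OF cl_hom])

lemma cl_conv: "f \<in> carrier R \<Longrightarrow> g \<in> carrier R \<Longrightarrow> cl (conv f g) = cl f \<otimes>\<^bsub>AA\<^esub> cl g"
  using ring_hom_mult[OF cl_hom, of f g] by simp

lemma cl_surj: "a \<in> carrier AA \<Longrightarrow> \<exists>f\<in>carrier R. cl f = a"
  unfolding cl_eq by (auto simp: Aalg_def FactRing_def A_RCOSETS_def')

lemma cl_eq_iff: "f \<in> carrier R \<Longrightarrow> g \<in> carrier R \<Longrightarrow> cl f = cl g \<longleftrightarrow> f - g \<in> I"
  using FA.quotient_eq_iff_same_a_r_cos[OF ideal_I, of f g] by (simp add: cl_eq minus_FA)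

lemma cl_diff:
  assumes "f \<in> carrier R" "g \<in> carrier R"
  shows "cl (f - g) = cl f \<ominus>\<^bsub>AA\<^esub> cl g"
proof -
  have "cl f = cl (f - g) \<oplus>\<^bsub>AA\<^esub> cl g"
    using ring_hom_add[OF cl_hom, of "f - g" g] assms by (simp add: minus_closed)
  then show ?thesis
    using assms by (simp add: A.minus_eq A.a_assoc A.r_neg minus_closed)
qed

abbreviation "J \<equiv> tm1A n S tq tlam"

lemma tm1_eq: "tm1 n S tq tlam = cl (sc tau)" by (simp add: tm1_def tau_def)

lemma tau_closed [simp]: "sc tau \<in> carrier R" by (simp add: S_tau)

lemma J_iff: "a \<in> J \<longleftrightarrow> (\<exists>f\<in>carrier R. a = cl (conv (sc tau) f))"
proof
  assume "a \<in> J"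
  then obtain b where "b \<in> carrier AA" "a = cl (sc tau) \<otimes>\<^bsub>AA\<^esub> b"
    unfolding tm1A_def tm1_eq by blast
  moreover from this(1) obtain f where "f \<in> carrier R" "cl f = b" using cl_surj by blast
  ultimately show "\<exists>f\<in>carrier R. a = cl (conv (sc tau) f)" by (metis cl_conv tau_closed)
next
  assume "\<exists>f\<in>carrier R. a = cl (conv (sc tau) f)"
  then obtain f where "f \<in> carrier R" "a = cl (sc tau) \<otimes>\<^bsub>AA\<^esub> cl f" by (auto simp: cl_conv)
  then show "a \<in> J" unfolding tm1A_def tm1_eq using cl_closed by blast
qed

lemma ideal_J: "ideal J AA"
  unfolding tm1A_def tm1_eq
proof (rule central_multiples_ideal[OF ring_A])
  fix a assume "a \<in> carrier AA"
  then obtain f where f: "f \<in> carrier R" "cl f = a" using cl_surj by blast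
  have "conv f (sc tau) = conv (sc tau) f" by (simp add: sc_mono conv_scalar_left conv_scalar_right)
  then show "a \<otimes>\<^bsub>AA\<^esub> cl (sc tau) = cl (sc tau) \<otimes>\<^bsub>AA\<^esub> a"
    using cl_conv[of f "sc tau"] cl_conv[of "sc tau" f] f by simp
qed simp

lemma cl1_eq: "cl1 = (+>\<^bsub>AA\<^esub>) J \<circ> cl" by (rule ext) (simp add: cls1_def)

lemma ring_A1: "ring AA1" unfolding A1alg_def by (rule ideal.quotient_is_ring[OF ideal_J])

sublocale A1: ring AA1 by (rule ring_A1)

lemma cl1_hom: "cl1 \<in> ring_hom R AA1"
  unfolding cl1_eq A1alg_def by (rule ring_hom_trans[OF cl_hom ideal.rcos_ring_hom[OF ideal_J]])

lemma cl1_closed [simp]: "f \<in> carrier R \<Longrightarrow> cl1 f \<in> carrier AA1"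
  by (rule ring_hom_closed[OF cl1_hom])

lemma cl1_conv: "f \<in> carrier R \<Longrightarrow> g \<in> carrier R \<Longrightarrow> cl1 (conv f g) = cl1 f \<otimes>\<^bsub>AA1\<^esub> cl1 g"
  using ring_hom_mult[OF cl1_hom, of f g] by simp

lemma cl1_add: "f \<in> carrier R \<Longrightarrow> g \<in> carrier R \<Longrightarrow> cl1 (f + g) = cl1 f \<oplus>\<^bsub>AA1\<^esub> cl1 g"
  using ring_hom_add[OF cl1_hom, of f g] by simp

lemma cl1_surj: "a \<in> carrier AA1 \<Longrightarrow> \<exists>f\<in>carrier R. cl1 f = a"
  unfolding cl1_eq using cl_surj by (fastforce simp: A1alg_def FactRing_def A_RCOSETS_def')

text \<open>Removes both layers of cosets: equality in \<open>A_1\<close> becomes congruence in the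
  free algebra modulo \<open>I\<close> and multiples of \<open>tau\<close>.\<close>

lemma cl1_eq_iff:
  assumes f: "f \<in> carrier R" and g: "g \<in> carrier R"
  shows "cl1 f = cl1 g \<longleftrightarrow> (\<exists>h\<in>carrier R. f - g - conv (sc tau) h \<in> I)"
proof -
  have "cl1 f = cl1 g \<longleftrightarrow> cl (f - g) \<in> J"
    using A.quotient_eq_iff_same_a_r_cos[OF ideal_J, of "cl f" "cl g"] f g by (simp add: cl1_eq cl_diff)
  also have "\<dots> \<longleftrightarrow> (\<exists>h\<in>carrier R. f - g - conv (sc tau) h \<in> I)"
    unfolding J_iff by (intro bex_cong refl cl_eq_iff minus_closed conv_closed f g tau_closed)
  finally show ?thesis .
qed

lemma cl1_eq_zero_iff:
  assumes "f \<in> carrier R"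
  shows "cl1 f = \<zero>\<^bsub>AA1\<^esub> \<longleftrightarrow> (\<exists>h\<in>carrier R. f - conv (sc tau) h \<in> I)"
proof -
  have "cl1 0 = \<zero>\<^bsub>AA1\<^esub>" using ring_hom_zero[OF cl1_hom ring_FA ring_A1] by simp
  then show ?thesis using cl1_eq_iff[OF assms zero_closed] by simp
qed

lemma zero_I: "0 \<in> I"
  using additive_subgroup.zero_closed[OF ideal.axioms(1)[OF ideal_I]] by simp

section \<open>Commutators of letters as multiples of \<open>t - 1\<close>\<close>

definition quot_tau :: "cf \<Rightarrow> cf" where "quot_tau c = (c - 1) / tau"

lemma quot_tau_nonunit: "f \<in> S \<Longrightarrow> ev1 f = 0 \<Longrightarrow> f / tau \<in> S"
  using S_divide[of f] tau_nz by (metis nonzero_mult_div_cancel_left)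

lemma quot_tau:
  assumes "c \<in> S" "c \<in> one_units"
  shows "quot_tau c \<in> S" "c = 1 + tau * quot_tau c" "ev1 (quot_tau c) = d1 c"
proof -
  have "ev1 (c - 1) = 0" using assms by (simp add: one_units_def ev1_diff)
  then show S: "quot_tau c \<in> S" unfolding quot_tau_def
    by (rule quot_tau_nonunit[OF S_diff[OF assms(1) S_1]])
  show c: "c = 1 + tau * quot_tau c" using tau_nz by (simp add: quot_tau_def)
  show "ev1 (quot_tau c) = d1 c" by (rule ev1_quotient[OF c S_regular[OF S]])
qed

text \<open>Modulo the relation \<open>f g = c g f\<close> the commutator is
  \<open>(c - 1) g f\<close>; this is its quotient by \<open>tau\<close>.\<close>

definition comm_quot :: "cf \<Rightarrow> fa \<Rightarrow> fa \<Rightarrow> fa" where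
  "comm_quot c f g = conv (conv (sc (quot_tau c)) g) f"

lemma relator_bracket:
  assumes "c \<in> S" "c \<in> one_units" and rel: "relator c f g \<in> I"
  shows "conv f g - conv g f - conv (sc tau) (comm_quot c f g) \<in> I"
proof -
  have "c * z = z + tau * (quot_tau c * z)" for z
    using arg_cong[OF quot_tau(2)[OF assms(1,2)], of "\<lambda>c. c * z"] by (simp add: algebra_simps)
  then have "conv f g - conv g f - conv (sc tau) (comm_quot c f g) = relator c f g"
    unfolding relator_def comm_quot_def conv_sc conv_scale_left by (simp add: fun_eq_iff)
  then show ?thesis using rel by simp
qed

definition normal_sum :: "nat \<Rightarrow> fa" where
  "normal_sum i = wmono 1 [] + (\<Sum>k\<in>{1..i}. conv (Yg k) (Xg k))"

text \<open>Subtracting \<open>y_i x_i\<close> from both sides of the relation leaves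
  \<open>tq i - 1\<close> times \<open>y_i x_i\<close> plus the sum up to \<open>i - 1\<close>. The
  two merge, which is why the bracket has a sum up to \<open>i\<close>.\<close>

lemma relator_diag_bracket:
  assumes i: "i \<in> {1..n}"
  shows "conv (Xg i) (Yg i) - conv (Yg i) (Xg i)
    - conv (sc tau) (conv (sc (quot_tau (tq i))) (normal_sum i)) \<in> I"
proof -
  have "{1..i} = insert i {1..<i}" using i by auto
  then have s: "normal_sum i = conv (Yg i) (Xg i) + (wmono 1 [] + (\<Sum>k\<in>{1..<i}. conv (Yg k) (Xg k)))"
    unfolding normal_sum_def by (simp add: add_ac)
  have e: "tq i * z = z + tau * (quot_tau (tq i) * z)" for z
    using arg_cong[OF quot_tau(2)[of "tq i"], of "\<lambda>c. c * z"] tq[OF i] by (simp add: algebra_simps)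
  have "conv (Xg i) (Yg i) - conv (Yg i) (Xg i)
      - conv (sc tau) (conv (sc (quot_tau (tq i))) (normal_sum i)) = relator_diag i"
    unfolding relator_diag_def relator_def s conv_sc conv_scale_left
    by (rule ext) (simp add: e ring_distribs)
  moreover have "relator_diag i \<in> rels n S tq tlam" unfolding rels_eq using i by auto
  ultimately show ?thesis using rels_I by metis
qed

lemma brackets:
  assumes ij: "1 \<le> i" "i < j" "j \<le> n"
  shows "conv (Yg j) (Yg i) - conv (Yg i) (Yg j) - conv (sc tau) (comm_quot (tlam j i) (Yg j) (Yg i)) \<in> I"
    and "conv (Yg j) (Xg i) - conv (Xg i) (Yg j) - conv (sc tau) (comm_quot (tlam i j) (Yg j) (Xg i)) \<in> I"
    and "conv (Xg j) (Yg i) - conv (Yg i) (Xg j) - conv (sc tau) (comm_quot (tq i * tlam i j) (Xg j) (Yg i)) \<in> I"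
    and "conv (Xg j) (Xg i) - conv (Xg i) (Xg j)
      - conv (sc tau) (comm_quot (inverse (tq i) * inverse (tlam i j)) (Xg j) (Xg i)) \<in> I"
proof -
  have m: "i \<in> {1..n}" "j \<in> {1..n}" using ij by auto
  show "conv (Yg j) (Yg i) - conv (Yg i) (Yg j) - conv (sc tau) (comm_quot (tlam j i) (Yg j) (Yg i)) \<in> I"
    by (rule relator_bracket[OF scalars_S(1)[OF m(2,1)] scalars_S(4)[OF m(2,1)] rels_I])
      (unfold rels_eq, use ij in blast)
  show "conv (Yg j) (Xg i) - conv (Xg i) (Yg j) - conv (sc tau) (comm_quot (tlam i j) (Yg j) (Xg i)) \<in> I"
    by (rule relator_bracket[OF scalars_S(1)[OF m] scalars_S(4)[OF m] rels_I])
      (unfold rels_eq, use ij in blast)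
  show "conv (Xg j) (Yg i) - conv (Yg i) (Xg j) - conv (sc tau) (comm_quot (tq i * tlam i j) (Xg j) (Yg i)) \<in> I"
    by (rule relator_bracket[OF scalars_S(2)[OF m] scalars_S(5)[OF m] rels_I])
      (unfold rels_eq, use ij in blast)
  show "conv (Xg j) (Xg i) - conv (Xg i) (Xg j)
      - conv (sc tau) (comm_quot (inverse (tq i) * inverse (tlam i j)) (Xg j) (Xg i)) \<in> I"
    by (rule relator_bracket[OF scalars_S(3)[OF m] scalars_S(6)[OF m] rels_I])
      (unfold rels_eq, use ij in blast)
qed

lemma comm_quot_closed [simp]:
  "c \<in> S \<Longrightarrow> c \<in> one_units \<Longrightarrow> f \<in> carrier R \<Longrightarrow> g \<in> carrier R \<Longrightarrow> comm_quot c f g \<in> carrier R"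
  unfolding comm_quot_def using quot_tau(1) by (intro conv_closed sc_closed) auto

lemma cl1_commute_of_bracket:
  assumes "f \<in> carrier R" "g \<in> carrier R" "h \<in> carrier R" "conv f g - conv g f - conv (sc tau) h \<in> I"
  shows "cl1 f \<otimes>\<^bsub>AA1\<^esub> cl1 g = cl1 g \<otimes>\<^bsub>AA1\<^esub> cl1 f"
  using cl1_eq_iff[OF conv_closed[OF assms(1,2)] conv_closed[OF assms(2,1)]] assms
  by (auto simp: cl1_conv)

section \<open>Commutativity of the fibre and the kernel of \<open>Phi\<close>\<close>

lemma cl1_gen_commute:
  assumes "a \<in> Vn n" "b \<in> Vn n"
  shows "cl1 (gen a) \<otimes>\<^bsub>AA1\<^esub> cl1 (gen b) = cl1 (gen b) \<otimes>\<^bsub>AA1\<^esub> cl1 (gen a)"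
proof -
  let ?C = "\<lambda>f g. cl1 f \<otimes>\<^bsub>AA1\<^esub> cl1 g = cl1 g \<otimes>\<^bsub>AA1\<^esub> cl1 f"
  have off: "?C (Yg j) (Yg i) \<and> ?C (Yg j) (Xg i) \<and> ?C (Xg j) (Yg i) \<and> ?C (Xg j) (Xg i)"
    if "1 \<le> i" "i < j" "j \<le> n" for i j
  proof -
    have m: "i \<in> {1..n}" "j \<in> {1..n}" using that by auto
    note b = brackets[OF that]
    show ?thesis
      by (intro conjI cl1_commute_of_bracket[OF _ _ _ b(1)] cl1_commute_of_bracket[OF _ _ _ b(2)]
        cl1_commute_of_bracket[OF _ _ _ b(3)] cl1_commute_of_bracket[OF _ _ _ b(4)] comm_quot_closed
        scalars_S letter_closed m)
  qed
  have diag: "?C (Xg i) (Yg i)" if i: "i \<in> {1..n}" for i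
    by (rule cl1_commute_of_bracket[OF _ _ _ relator_diag_bracket[OF i]])
      (use i tq[OF i] quot_tau(1)[of "tq i"] normal_sum_closed[of i] in \<open>auto simp: normal_sum_def intro!: conv_closed\<close>)
  obtain i where i: "i \<in> {1..n}" "gen a = Yg i \<or> gen a = Xg i"
    using assms(1) unfolding Vn_def Yg_def Xg_def by blast
  obtain j where j: "j \<in> {1..n}" "gen b = Yg j \<or> gen b = Xg j"
    using assms(2) unfolding Vn_def Yg_def Xg_def by blast
  consider "i < j" | "j < i" | "i = j" by linarith
  then show ?thesis
  proof cases
    case 1
    then have "1 \<le> i" "j \<le> n" using i j by auto
    from off[OF this(1) 1 this(2)] i(2) j(2) show ?thesis by metis
  next
    case 2
    then have "1 \<le> j" "i \<le> n" using i j by auto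
    from off[OF this(1) 2 this(2)] i(2) j(2) show ?thesis by metis
  next
    case 3
    from diag[OF i(1)] i(2) j(2) show ?thesis unfolding 3 by metis
  qed
qed

lemma word_closed: "set w \<subseteq> Vn n \<Longrightarrow> wmono 1 w \<in> carrier R"
  by (rule mono_closed[OF S_1])

lemma wmono_Cons: "wmono 1 (k # w) = conv (gen k) (wmono 1 w)"
  by (simp add: gen_mono conv_mono_mono)

text \<open>Insertion moves \<open>k\<close> past one letter at a time, and each such swap is an
  equality in \<open>A_1\<close>.\<close>

lemma cl1_insort:
  assumes "k \<in> Vn n" "set w \<subseteq> Vn n"
  shows "cl1 (wmono 1 (insort k w)) = cl1 (gen k) \<otimes>\<^bsub>AA1\<^esub> cl1 (wmono 1 w)"
  using assms(2)
proof (induction w)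
  case Nil
  then show ?case using assms(1) by (simp add: wmono_Cons cl1_conv gen_closed word_closed)
next
  case (Cons b w)
  have b: "b \<in> Vn n" "set w \<subseteq> Vn n" using Cons.prems by auto
  have "cl1 (gen b) \<otimes>\<^bsub>AA1\<^esub> (cl1 (gen k) \<otimes>\<^bsub>AA1\<^esub> cl1 (wmono 1 w))
      = cl1 (gen k) \<otimes>\<^bsub>AA1\<^esub> (cl1 (gen b) \<otimes>\<^bsub>AA1\<^esub> cl1 (wmono 1 w))"
    using cl1_gen_commute[OF assms(1) b(1)] assms(1) b
    by (simp add: A1.m_assoc[symmetric] gen_closed word_closed)
  then show ?case
    using Cons assms(1) b
    by (simp add: wmono_Cons cl1_conv gen_closed word_closed conv_closed set_insort_key)
qed

lemma cl1_sort: "set w \<subseteq> Vn n \<Longrightarrow> cl1 (wmono 1 (sort w)) = cl1 (wmono 1 w)"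
proof (induction w)
  case (Cons k w)
  then show ?case
    by (simp add: cl1_insort wmono_Cons cl1_conv gen_closed word_closed)
qed simp

lemma cl1_sort_scaled:
  assumes "c \<in> S" "set w \<subseteq> Vn n"
  shows "cl1 (wmono c w) = cl1 (wmono c (sort w))"
proof -
  have "wmono c v = conv (sc c) (wmono 1 v)" for v by (simp add: sc_mono conv_mono_mono)
  then show ?thesis using assms cl1_sort[OF assms(2)] by (simp add: cl1_conv word_closed)
qed

lemma cl1_sum_cong:
  assumes "finite B" "\<And>i. i \<in> B \<Longrightarrow> f i \<in> carrier R" "\<And>i. i \<in> B \<Longrightarrow> g i \<in> carrier R"
    "\<And>i. i \<in> B \<Longrightarrow> cl1 (f i) = cl1 (g i)"
  shows "cl1 (sum f B) = cl1 (sum g B)"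
  using assms by (induction B rule: finite_induct) (simp_all add: cl1_add sum_closed)

lemma kernel:
  assumes x: "x \<in> carrier R"
  shows "cl1 x = \<zero>\<^bsub>AA1\<^esub> \<longleftrightarrow> Phi x = 0"
proof
  assume "cl1 x = \<zero>\<^bsub>AA1\<^esub>"
  then obtain h where h: "h \<in> carrier R" "x - conv (sc tau) h \<in> I"
    using cl1_eq_zero_iff[OF x] by blast
  then have "Phi x - Phi (sc tau) * Phi h = 0"
    using Phi_I[OF h(2)] x by (simp add: Phi_diff Phi_conv conv_closed)
  then show "Phi x = 0" by (simp add: Phi_sc S_tau pconst_def)
next
  assume 0: "Phi x = 0"
  have fin: "finite (supp x)" and xS: "\<And>w. x w \<in> S" and V: "\<And>w. w \<in> supp x \<Longrightarrow> set w \<subseteq> Vn n"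
    using x unfolding carrier_FA supp_def by blast+
  \<comment> \<open>Sorting every word does not change the class in \<open>A\<^sub>1\<close>; the coefficients that result are those of \<open>Phi x\<close>
    before specialisation, so they are divisible by \<open>t - 1\<close>.\<close>
  define x' where "x' = (\<Sum>w\<in>supp x. wmono (x w) (sort w))"
  have "x = (\<Sum>w\<in>supp x. wmono (x w) w)"
    using fin by (auto simp: fun_eq_iff sum_fun_apply wmono_def supp_def)
  then have "cl1 x = cl1 (\<Sum>w\<in>supp x. wmono (x w) w)" by (rule arg_cong)
  also have "\<dots> = cl1 x'"
    unfolding x'_def by (rule cl1_sum_cong) (simp_all add: fin xS V mono_closed cl1_sort_scaled[symmetric])
  also have "\<dots> = \<zero>\<^bsub>AA1\<^esub>"
  proof -
    have x': "x' \<in> carrier R"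
      unfolding x'_def by (rule sum_closed) (simp add: xS V mono_closed)
    have val: "x' v = (\<Sum>w | w \<in> supp x \<and> sort w = v. x w)" for v
      using fin unfolding x'_def sum_fun_apply
      by (simp add: wmono_def sum.If_cases Int_def eq_commute[of v])
    have "ev1 (x' v) = 0" for v
    \<comment> \<open>For sorted \<open>v\<close> the words that sort to \<open>v\<close> are those
      with the exponents of \<open>v\<close>, so the sum is a coefficient of \<open>Phi x\<close>;
      for unsorted \<open>v\<close> there are none.\<close>
    proof (cases "sort v = v")
      case True
      have "ev1 (x' v) = (\<Sum>w | w \<in> supp x \<and> sort w = v. ev1 (x w))"
        unfolding val using regular_at_1_sum[of _ x] S_regular[OF xS] by blast
      also have "{w. w \<in> supp x \<and> sort w = v} = {w. w \<in> supp x \<and> wexp w = wexp v}"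
        unfolding wexp_eq_iff using True by (metis (mono_tags, lifting) mset_sort properties_for_sort sorted_sort)
      also have "(\<Sum>w\<in>\<dots>. ev1 (x w)) = 0"
        using lookup_Phi[OF fin order_refl, of "wexp v"] 0 by simp
      finally show ?thesis .
    next
      case False
      then have "{w. w \<in> supp x \<and> sort w = v} = {}" by (auto simp: sorted_sort_id)
      then show ?thesis unfolding val by (simp only: sum.empty ev1_const)
    qed
    then have S: "x' v / tau \<in> S" for v
      using x' quot_tau_nonunit[of "x' v"] by (auto simp: carrier_FA)
    define y where "y = (\<lambda>v. x' v / tau)"
    have "supp y = supp x'" using tau_nz by (auto simp: supp_def y_def)
    then have y: "y \<in> carrier R" using x' S unfolding carrier_FA by (auto simp: y_def)
    have "x' - conv (sc tau) y = 0" using tau_nz by (simp add: conv_sc y_def fun_eq_iff)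
    then show ?thesis unfolding cl1_eq_zero_iff[OF x'] using zero_I y by metis
  qed
  finally show "cl1 x = \<zero>\<^bsub>AA1\<^esub>" .
qed

lemma cl1_eq_iff_Phi:
  assumes "f \<in> carrier R" "g \<in> carrier R"
  shows "cl1 f = cl1 g \<longleftrightarrow> Phi f = Phi g"
  using kernel[OF minus_closed[OF assms]] cl1_eq_zero_iff[OF minus_closed[OF assms]] cl1_eq_iff[OF assms]
    Phi_diff[OF assms] by auto

lemma A1_commute:
  assumes "a \<in> carrier AA1" "b \<in> carrier AA1"
  shows "a \<otimes>\<^bsub>AA1\<^esub> b = b \<otimes>\<^bsub>AA1\<^esub> a"
proof -
  obtain f g where fg: "f \<in> carrier R" "cl1 f = a" "g \<in> carrier R" "cl1 g = b"
    using cl1_surj assms by meson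
  have "cl1 (conv f g) = cl1 (conv g f)"
    using fg cl1_eq_iff_Phi[of "conv f g" "conv g f"] by (simp add: Phi_conv conv_closed mult.commute)
  then show ?thesis using fg by (simp add: cl1_conv)
qed

lemma A1_iso: "\<exists>\<phi>\<in>ring_iso AA1 (PR (Vn n)). \<forall>f\<in>carrier R. \<phi> (cl1 f) = Phi f"
  by (rule ring_iso_of_same_kernel[OF cl1_hom cl1_surj Phi_hom Phi_surj cl1_eq_iff_Phi ring_FA])

section \<open>Values of the bracket\<close>

text \<open>The element chosen by \<open>SOME\<close> in the definition of \<open>PB\<close> is determined only up to \<open>(t - 1)\<close>-torsion,
  which \<open>tau_torsion\<close> shows to vanish in \<open>A\<^sub>1\<close>.\<close>

lemma PB_eqI:
  assumes f: "f \<in> carrier R" and g: "g \<in> carrier R" and h: "h \<in> carrier R"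
    and bracket: "conv f g - conv g f - conv (sc tau) h \<in> I"
    and e: "e \<in> carrier R" "Phi h = Phi e"
  shows "PB n S tq tlam (cl f) (cl g) = cl1 e"
proof -
  have c: "conv f g - conv g f \<in> carrier R" using f g by (intro minus_closed conv_closed)
  have rhs: "cl f \<otimes>\<^bsub>AA\<^esub> cl g \<ominus>\<^bsub>AA\<^esub> cl g \<otimes>\<^bsub>AA\<^esub> cl f = cl (conv f g - conv g f)"
    using f g by (simp add: cl_diff cl_conv conv_closed)
  let ?D = "\<lambda>d. d \<in> carrier AA \<and> cl (sc tau) \<otimes>\<^bsub>AA\<^esub> d = cl (conv f g - conv g f)"
  have "?D (cl h)"
    using cl_eq_iff[OF c conv_closed[OF tau_closed h]] bracket h by (simp add: cl_conv)
  then have D: "?D (SOME d. ?D d)" by (rule someI[of ?D "cl h"])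
  then obtain d where d: "d \<in> carrier R" "cl d = (SOME d. ?D d)" using cl_surj by blast
  \<comment> \<open>Two quotients of one commutator: their difference is killed by
    \<open>tau\<close> in \<open>A\<close>.\<close>
  have "cl (conv (sc tau) d) = cl (conv (sc tau) h)"
    using D \<open>?D (cl h)\<close> d h by (simp add: cl_conv)
  then have "conv (sc tau) d - conv (sc tau) h \<in> I"
    using cl_eq_iff[OF conv_closed[OF tau_closed d(1)] conv_closed[OF tau_closed h]] by simp
  moreover have "conv (sc tau) d - conv (sc tau) h = conv (sc tau) (d - h)"
    by (simp add: conv_sc fun_eq_iff algebra_simps)
  ultimately have "Phi (d - h) = 0" using tau_torsion[of "d - h"] d h by (simp add: minus_closed)
  then have "Phi d = Phi e" using e d h by (simp add: Phi_diff)
  then have "cl1 d = cl1 e" using cl1_eq_iff_Phi d e by blast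
  then show ?thesis unfolding PB_def Let_def tm1_eq rhs d(2)[symmetric] by (simp add: cl1_eq)
qed

text \<open>\<open>quot_tau c\<close> may depend on \<open>t\<close>, but in \<open>A_1\<close> it
  can be replaced by its value at 1, the derivative of \<open>c\<close>. Keeping \<open>z\<close>
  separate allows the derivative of a product to be entered as a sum.\<close>

lemma PB_relator:
  assumes c: "c \<in> S" "c \<in> one_units" and f: "f \<in> carrier R" "g \<in> carrier R"
    and b: "conv f g - conv g f - conv (sc tau) (comm_quot c f g) \<in> I" and z: "d1 c = z"
  shows "PB n S tq tlam (cl f) (cl g) = cl1 (conv (conv (sc (cst z)) g) f)"
proof (rule PB_eqI[OF f comm_quot_closed[OF c f] b])
  show "conv (conv (sc (cst z)) g) f \<in> carrier R" using f by (intro conv_closed sc_closed S_cst)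
  show "Phi (comm_quot c f g) = Phi (conv (conv (sc (cst z)) g) f)"
    using f quot_tau[OF c] z unfolding comm_quot_def by (simp add: Phi_conv Phi_sc conv_closed S_cst)
qed

lemma PB_formulas:
  assumes ij: "1 \<le> i" "i < j" "j \<le> n"
  shows "PB n S tq tlam (cl (Yg j)) (cl (Yg i)) = cl1 (conv (conv (sc (cst (d1 (tlam j i)))) (Yg i)) (Yg j))"
    and "PB n S tq tlam (cl (Yg j)) (cl (Xg i)) = cl1 (conv (conv (sc (cst (d1 (tlam i j)))) (Xg i)) (Yg j))"
    and "PB n S tq tlam (cl (Xg j)) (cl (Yg i))
      = cl1 (conv (conv (sc (cst (d1 (tq i) + d1 (tlam i j)))) (Yg i)) (Xg j))"
    and "PB n S tq tlam (cl (Xg j)) (cl (Xg i))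
      = cl1 (conv (conv (sc (cst (- (d1 (tq i) + d1 (tlam i j))))) (Xg i)) (Xg j))"
proof -
  have m: "i \<in> {1..n}" "j \<in> {1..n}" using ij by auto
  note U = tq[OF m(1)] tlam[OF m] 
  show "PB n S tq tlam (cl (Yg j)) (cl (Yg i)) = cl1 (conv (conv (sc (cst (d1 (tlam j i)))) (Yg i)) (Yg j))"
    by (rule PB_relator[OF _ _ _ _ brackets(1)[OF ij]]) (simp_all only: m scalars_S letter_closed)
  show "PB n S tq tlam (cl (Yg j)) (cl (Xg i)) = cl1 (conv (conv (sc (cst (d1 (tlam i j)))) (Xg i)) (Yg j))"
    by (rule PB_relator[OF _ _ _ _ brackets(2)[OF ij]]) (simp_all only: m scalars_S letter_closed)
  have "d1 (tq i * tlam i j) = d1 (tq i) + d1 (tlam i j)" using U by (simp add: one_units_mult)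
  then show "PB n S tq tlam (cl (Xg j)) (cl (Yg i))
      = cl1 (conv (conv (sc (cst (d1 (tq i) + d1 (tlam i j)))) (Yg i)) (Xg j))"
    by (intro PB_relator[OF _ _ _ _ brackets(3)[OF ij]]) (simp_all only: m scalars_S letter_closed)
  have "d1 (inverse (tq i) * inverse (tlam i j)) = - (d1 (tq i) + d1 (tlam i j))"
    using U by (simp add: one_units_mult one_units_inverse)
  then show "PB n S tq tlam (cl (Xg j)) (cl (Xg i))
      = cl1 (conv (conv (sc (cst (- (d1 (tq i) + d1 (tlam i j))))) (Xg i)) (Xg j))"
    by (intro PB_relator[OF _ _ _ _ brackets(4)[OF ij]]) (simp_all only: m scalars_S letter_closed)
qed

lemma PB_diag:
  assumes i: "i \<in> {1..n}"
  shows "PB n S tq tlam (cl (Xg i)) (cl (Yg i)) = cl1 (conv (sc (cst (d1 (tq i)))) (normal_sum i))"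
proof -
  have N: "normal_sum i \<in> carrier R" using i normal_sum_closed[of i] by (simp add: normal_sum_def)
  have q: "quot_tau (tq i) \<in> S" "ev1 (quot_tau (tq i)) = d1 (tq i)" using quot_tau tq[OF i] by auto
  show ?thesis
    by (rule PB_eqI[OF _ _ _ relator_diag_bracket[OF i]])
      (use i N q in \<open>simp_all add: conv_closed S_cst Phi_conv Phi_sc\<close>)
qed

end

lemma (in weyl_data) normal_sum_FA:
  assumes "i \<in> {1..n}"
  shows "\<one>\<^bsub>R\<^esub> \<oplus>\<^bsub>R\<^esub> (\<Oplus>\<^bsub>R\<^esub>k\<in>{1..i}. Yg k \<otimes>\<^bsub>R\<^esub> Xg k) = normal_sum i"
proof -
  have "(\<Oplus>\<^bsub>R\<^esub>k\<in>{1..i}. conv (Yg k) (Xg k)) = (\<Sum>k\<in>{1..i}. conv (Yg k) (Xg k))"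
    by (rule finsum_FA) (use assms in \<open>auto intro!: conv_closed\<close>)
  then show ?thesis by (simp add: normal_sum_def)
qed

section \<open>The given scalars as members of the group\<close>

lemma Ggen_nz:
  assumes "\<forall>i\<in>{1..n}. Q i \<noteq> 0" "\<forall>i\<in>{1..n}. \<forall>j\<in>{1..n}. L i j \<noteq> 0" "c \<in> Ggen n Q L"
  shows "c \<noteq> 0"
  using assms unfolding Ggen_def by auto

lemma prod_powi_indicator:
  fixes f :: "nat \<Rightarrow> 'a :: field"
  assumes "finite A" "i \<in> A"
  shows "(\<Prod>k\<in>A. f k powi (if k = i then 1 else 0)) = f i"
proof -
  have "(\<Prod>k\<in>A. f k powi (if k = i then 1 else 0)) = (\<Prod>k\<in>A. if k = i then f k else 1)"
    by (rule prod.cong) auto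
  then show ?thesis using assms by simp
qed

lemma Ggen_Q:
  assumes "i \<in> {1..n}"
  shows "Q i \<in> Ggen n Q L"
proof -
  have "Q i = (\<Prod>k\<in>{1..n}. Q k powi (if k = i then 1 else 0)) * (\<Prod>i\<in>{1..n}. \<Prod>j\<in>{1..n}. L i j powi 0)"
    using assms by (simp add: prod_powi_indicator)
  then show ?thesis unfolding Ggen_def by (intro CollectI exI conjI TrueI)
qed

lemma Ggen_L:
  assumes "i \<in> {1..n}" "j \<in> {1..n}"
  shows "L i j \<in> Ggen n Q L"
proof -
  have "(\<Prod>k\<in>{1..n}. \<Prod>l\<in>{1..n}. L k l powi (if k = i then if l = j then 1 else 0 else 0))
      = (\<Prod>k\<in>{1..n}. if k = i then L i j else 1)"
    by (intro prod.cong refl) (use assms in \<open>auto simp: prod_powi_indicator\<close>)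
  then have "L i j = (\<Prod>k\<in>{1..n}. Q k powi 0)
      * (\<Prod>k\<in>{1..n}. \<Prod>l\<in>{1..n}. L k l powi (if k = i then if l = j then 1 else 0 else 0))"
    using assms by simp
  then show ?thesis unfolding Ggen_def by (intro CollectI exI conjI TrueI)
qed

theorem theorem2p9:
  fixes n r :: nat and Q :: "nat \<Rightarrow> complex" and L :: "nat \<Rightarrow> nat \<Rightarrow> complex"
    and eta mu :: "nat \<Rightarrow> complex" and q :: complex
    and E :: "nat \<Rightarrow> complex poly" and S :: "cf set"
    and tq :: "nat \<Rightarrow> cf" and tlam :: "nat \<Rightarrow> nat \<Rightarrow> cf"
    and A1 :: "fa set set ring" and c1 :: "fa \<Rightarrow> fa set set" and cA :: "fa \<Rightarrow> fa set"
    and R :: "fa ring"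
  assumes Q: "\<forall>i\<in>{1..n}. Q i \<noteq> 0 \<and> Q i \<noteq> 1"
    and L0: "\<forall>i\<in>{1..n}. \<forall>j\<in>{1..n}. L i j \<noteq> 0"
    and Ldiag: "\<forall>i\<in>{1..n}. L i i = 1"
    and Linv: "\<forall>i\<in>{1..n}. \<forall>j\<in>{1..n}. L i j = inverse (L j i)"
    and basis_mem: "\<forall>i\<in>{1..r}. eta i \<in> Ggen n Q L"
    and basis_span: "\<forall>c\<in>Ggen n Q L. \<exists>s :: nat \<Rightarrow> int. c = (\<Prod>i\<in>{1..r}. eta i powi s i)"
    and basis_free: "\<forall>s :: nat \<Rightarrow> int. (\<Prod>i\<in>{1..r}. eta i powi s i) = 1 \<longrightarrow> (\<forall>i\<in>{1..r}. s i = 0)"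
    and mu_indep: "\<forall>c :: nat \<Rightarrow> rat. (\<Sum>i\<in>{1..r}. of_rat (c i) * mu i) = 0 \<longrightarrow> (\<forall>i\<in>{1..r}. c i = 0)"
    and q: "q \<noteq> 0" "q \<noteq> 1" "\<forall>k::nat. k > 0 \<longrightarrow> q ^ k \<noteq> 1"
    and E_def: "E = (\<lambda>i. e_poly q (eta i) (mu i))"
    and S_def: "S = Fset r E"
    and tq_def: "tq = (\<lambda>i. tilde r eta E (Q i))"
    and tlam_def: "tlam = (\<lambda>i j. tilde r eta E (L i j))"
    and A1_def: "A1 = A1alg n S tq tlam"
    and c1_def: "c1 = cls1 n S tq tlam"
    and cA_def: "cA = clsA n S tq tlam"
    and R_def: "R = FA S (Vn n)"
  shows "(\<forall>i\<in>{1..n}. d1 (tq i) \<noteq> 0)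
    \<and> (\<forall>i\<in>{1..n}. \<forall>j\<in>{1..n}. d1 (tlam j i) = - d1 (tlam i j))
    \<and> (\<forall>a\<in>carrier A1. \<forall>b\<in>carrier A1. a \<otimes>\<^bsub>A1\<^esub> b = b \<otimes>\<^bsub>A1\<^esub> a)
    \<and> (\<exists>\<phi>. \<phi> \<in> ring_iso A1 (PR (Vn n))
          \<and> (\<forall>i\<in>{1..n}. \<phi> (c1 (Yg i)) = pvar (2 * i) \<and> \<phi> (c1 (Xg i)) = pvar (2 * i + 1))
          \<and> (\<forall>f\<in>S. \<phi> (c1 (sc f)) = pconst (ev1 f)))
    \<and> (\<forall>i j. 1 \<le> i \<and> i < j \<and> j \<le> n \<longrightarrow>
          PB n S tq tlam (cA (Yg j)) (cA (Yg i))
            = c1 (sc (cst (d1 (tlam j i))) \<otimes>\<^bsub>R\<^esub> Yg i \<otimes>\<^bsub>R\<^esub> Yg j)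
        \<and> PB n S tq tlam (cA (Yg j)) (cA (Xg i))
            = c1 (sc (cst (d1 (tlam i j))) \<otimes>\<^bsub>R\<^esub> Xg i \<otimes>\<^bsub>R\<^esub> Yg j)
        \<and> PB n S tq tlam (cA (Xg j)) (cA (Yg i))
            = c1 (sc (cst (d1 (tq i) + d1 (tlam i j))) \<otimes>\<^bsub>R\<^esub> Yg i \<otimes>\<^bsub>R\<^esub> Xg j)
        \<and> PB n S tq tlam (cA (Xg j)) (cA (Xg i))
            = c1 (sc (cst (- (d1 (tq i) + d1 (tlam i j)))) \<otimes>\<^bsub>R\<^esub> Xg i \<otimes>\<^bsub>R\<^esub> Xg j))
    \<and> (\<forall>i\<in>{1..n}. PB n S tq tlam (cA (Xg i)) (cA (Yg i))
          = c1 (sc (cst (d1 (tq i))) \<otimes>\<^bsub>R\<^esub> (\<one>\<^bsub>R\<^esub> \<oplus>\<^bsub>R\<^esub> (\<Oplus>\<^bsub>R\<^esub>k\<in>{1..i}. Yg k \<otimes>\<^bsub>R\<^esub> Xg k))))"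
proof -
  interpret B: free_basis r eta mu E
  proof unfold_locales
    show "eta i \<noteq> 0" if "i \<in> {1..r}" for i
      using Ggen_nz[of n Q L] Q L0 basis_mem that by blast
    show "\<forall>i\<in>{1..r}. s i = 0" if "(\<Prod>i\<in>{1..r}. eta i powi s i) = 1" for s :: "nat \<Rightarrow> int"
      using basis_free that by blast
    show "poly (E i) 1 = 1" "poly (pderiv (E i)) 1 = mu i" for i
      unfolding E_def using quadratic_interpolation[OF q(2)] by simp_all
  qed
  have eta_group: "c \<in> B.eta_group" if "c \<in> Ggen n Q L" for c
    using basis_span that unfolding B.eta_group_def by blast
  \<comment> \<open>The inverse of a lift is the lift of the inverse, so it lies in \<open>S\<close>
    as well.\<close>
  have unit: "tilde r eta E c \<in> S \<and> inverse (tilde r eta E c) \<in> S \<and> tilde r eta E c \<in> one_units"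
    if c: "c \<in> B.eta_group" for c
  proof -
    have inv: "inverse c \<in> B.eta_group"
      using c unfolding B.eta_group_def by (auto simp: prod_powi_minus[symmetric])
    show ?thesis
      using B.tilde_in_Fset[OF c] B.tilde_in_Fset[OF inv] B.tilde_inverse[OF c] c B.tilde_one_units(1)
      unfolding S_def B.eta_group_def by auto
  qed
  interpret W: weyl_data S n tq tlam
  proof unfold_locales
    show "0 \<in> S" "1 \<in> S" "tau \<in> S" "cst z \<in> S" for z
      unfolding S_def cst_def tau_def Zero_fract_def One_fract_def by (rule B.Fset_poly)+
    show "a + b \<in> S" "a * b \<in> S" if "a \<in> S" "b \<in> S" for a b
      using that unfolding S_def by (rule B.Fset_add, rule B.Fset_mult)
    show "- a \<in> S" "regular_at_1 a" if "a \<in> S" for a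
      using that unfolding S_def by (rule B.Fset_minus, rule B.Fset_regular)
    show "\<exists>c\<in>S. f = tau * c" if "f \<in> S" "ev1 f = 0" for f
      using that unfolding S_def by (rule B.Fset_divide_tau)
    show "tq i \<in> S \<and> inverse (tq i) \<in> S \<and> tq i \<in> one_units" if "i \<in> {1..n}" for i
      unfolding tq_def by (rule unit[OF eta_group[OF Ggen_Q[OF that]]])
    fix i j assume ij: "i \<in> {1..n}" "j \<in> {1..n}"
    show "tlam i j \<in> S \<and> tlam i j \<in> one_units"
      unfolding tlam_def using unit[OF eta_group[OF Ggen_L[OF ij]]] by blast
    have "L i j = inverse (L j i)" using Linv ij by blast
    then show "tlam i j = inverse (tlam j i)"
      unfolding tlam_def using B.tilde_inverse[OF eta_group[OF Ggen_L[OF ij(2,1)]]] by simp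
  qed
  have "\<forall>i\<in>{1..n}. d1 (tq i) \<noteq> 0"
    unfolding tq_def using B.d1_tilde_nz[OF mu_indep eta_group[OF Ggen_Q]] Q by blast
  moreover have "\<forall>i\<in>{1..n}. \<forall>j\<in>{1..n}. d1 (tlam j i) = - d1 (tlam i j)"
    using W.tlam_inv W.tlam one_units_inverse by metis
  moreover have "\<forall>a\<in>carrier A1. \<forall>b\<in>carrier A1. a \<otimes>\<^bsub>A1\<^esub> b = b \<otimes>\<^bsub>A1\<^esub> a"
    unfolding A1_def using W.A1_commute by blast
  moreover have "\<exists>\<phi>. \<phi> \<in> ring_iso A1 (PR (Vn n))
          \<and> (\<forall>i\<in>{1..n}. \<phi> (c1 (Yg i)) = pvar (2 * i) \<and> \<phi> (c1 (Xg i)) = pvar (2 * i + 1))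
          \<and> (\<forall>f\<in>S. \<phi> (c1 (sc f)) = pconst (ev1 f))"
  proof -
    \<comment> \<open>The isomorphism is induced by \<open>Phi\<close>, so its values on generators
      and scalars are those of \<open>Phi\<close>.\<close>
    obtain \<phi> where "\<phi> \<in> ring_iso A1 (PR (Vn n))" "\<And>f. f \<in> carrier W.R \<Longrightarrow> \<phi> (c1 f) = W.Phi f"
      unfolding A1_def c1_def using W.A1_iso by blast
    then show ?thesis
      by (intro exI[of _ \<phi>]) (simp add: W.Phi_sc del: atLeastAtMost_iff)
  qed
  moreover have "\<forall>i j. 1 \<le> i \<and> i < j \<and> j \<le> n \<longrightarrow>
          PB n S tq tlam (cA (Yg j)) (cA (Yg i))
            = c1 (sc (cst (d1 (tlam j i))) \<otimes>\<^bsub>R\<^esub> Yg i \<otimes>\<^bsub>R\<^esub> Yg j)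
        \<and> PB n S tq tlam (cA (Yg j)) (cA (Xg i))
            = c1 (sc (cst (d1 (tlam i j))) \<otimes>\<^bsub>R\<^esub> Xg i \<otimes>\<^bsub>R\<^esub> Yg j)
        \<and> PB n S tq tlam (cA (Xg j)) (cA (Yg i))
            = c1 (sc (cst (d1 (tq i) + d1 (tlam i j))) \<otimes>\<^bsub>R\<^esub> Yg i \<otimes>\<^bsub>R\<^esub> Xg j)
        \<and> PB n S tq tlam (cA (Xg j)) (cA (Xg i))
            = c1 (sc (cst (- (d1 (tq i) + d1 (tlam i j)))) \<otimes>\<^bsub>R\<^esub> Xg i \<otimes>\<^bsub>R\<^esub> Xg j)"
    unfolding c1_def cA_def R_def mult_FA
    by (intro allI impI conjI; elim conjE) (rule W.PB_formulas; assumption)+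
  moreover have "\<forall>i\<in>{1..n}. PB n S tq tlam (cA (Xg i)) (cA (Yg i))
          = c1 (sc (cst (d1 (tq i))) \<otimes>\<^bsub>R\<^esub> (\<one>\<^bsub>R\<^esub> \<oplus>\<^bsub>R\<^esub> (\<Oplus>\<^bsub>R\<^esub>k\<in>{1..i}. Yg k \<otimes>\<^bsub>R\<^esub> Xg k)))"
  proof
    fix i assume "i \<in> {1..n}"
    from W.PB_diag[OF this] W.normal_sum_FA[OF this]
    show "PB n S tq tlam (cA (Xg i)) (cA (Yg i))
          = c1 (sc (cst (d1 (tq i))) \<otimes>\<^bsub>R\<^esub> (\<one>\<^bsub>R\<^esub> \<oplus>\<^bsub>R\<^esub> (\<Oplus>\<^bsub>R\<^esub>k\<in>{1..i}. Yg k \<otimes>\<^bsub>R\<^esub> Xg k)))"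
      unfolding c1_def cA_def R_def by (simp only: mult_FA)
  qed
  ultimately show ?thesis by (intro conjI)
qed

end
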